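(* Let an $r$-regular wavelet basis ($r$-RWB) be given such that there exists $0<\delta_1<1$ with $\psi(x)\ne0$ for all $x\in(0,1+\delta_1]$. Let $1<p<\infty$. For all $f\in\mathcal{S}([-1,1],d(r),\Delta_1,\Delta_2,N_S)$ there exists $N=N(f)$ such that for all $j\ge N$ $$\frac{1}{\Psi_0}\,\frac{\Psi_1}{m!\,2^{j(m+1/p)}}\,\Delta_1-O(2^{-j(m+1)})\le\|Q_jf\|_p\le\Psi_0\,\frac{\Psi_2\,(S(r))^{m+2}}{(m+1)!\,2^{j(m+1/p)}}\,N_S\Delta_2+O(2^{-j(m+1)}),$$ where $m=id(f)$.
   Context: **Wavelets.** Let $r\ge1$ be an integer. An $r$-regular wavelet basis ($r$-RWB) consists of a scaling function $\phi$ of a multiresolution analysis of $L^2(\mathbb{R})$ and the associated orthonormal real-valued wavelet $\psi$, both of class $C^r$ and compactly supported; we assume $\mathrm{supp}\,\psi=[0,S(r)]$ with $S(r)\in\mathbb{N}$. Put $\psi_{j,k}(x)=2^{j/2}\psi(2^jx-k)$. The integer $d(r)\ge r$ is the one for which $\int_{\mathbb{R}}x^k\psi(x)\,dx=0$ for $0\le k\le d(r)$ and $\int_{\mathbb{R}}x^{d(r)+1}\psi(x)\,dx\ne0$. For $j\ge0$ let $G_j(x,y)=\sum_{k\in\mathbb{Z}}\psi_{j,k}(x)\psi_{j,k}(y)$ and $Q_jf(x)=\int_{\mathbb{R}}G_j(x,y)f(y)\,dy$. $\|\cdot\|_p$ is the norm of $L^p(\mathbb{R})$. Constants: $$\Psi_0=\sup_{x\in\mathbb{R}}\sum_{k\in\mathbb{Z}}|\psi(x-k)|,\quad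 \Psi_2=\sup_{x\in\mathbb{R}}|\psi(x)|,\quad \Psi_1=\min_{0\le n\le d(r)}\left|\int_0^{\delta_1}(\delta_1-u)^n\psi(u)\,du\right|>0.$$ **Piecewise-smooth functions.** A function $f$ is piecewise-smooth with index $id(f)=m\ge0$ ($m$ an integer) if $f\in C^{m-1}(\mathbb{R})$ when $m\ge1$, and there exist $n\in\mathbb{N}$ and points $a_1<\dots<a_n$ (the defect points) such that $f\notin C^m(\{a_i\})$ for some $i$ and $f\in C^{m+1}$ on each of $(-\infty,a_1]$, $[a_i,a_{i+1}]$ ($i=1,\dots,n-1$), $[a_n,\infty)$. Here membership in $C^{m+1}$ of a closed interval means that the restriction to the interior extends to a $C^{m+1}$ function on the closed interval, and $f\notin C^m(\{a\})$ means $f^{(m)}(a^-)\neq f^{(m)}(a^+)$. **The class $\mathcal{S}$.** For $0<\Delta_1\le\Delta_2$ and $N_S\in\mathbb{N}$, $f\in\mathcal{S}([-1,1],d(r),\Delta_1,\Delta_2,N_S)$ means: $\mathrm{supp}\,f\subset[-1,1]$; $f$ is piecewise-smooth with $id(f)=m\le d(r)$; for each defect point $d$ of $f$, $\Delta_1\le|f^{(m)}(d^-)-f^{(m)}(d^+)|\le\Delta_2$; and the number of defect points is at most $N_S$. The $O(2^{-j(m+1)})$ terms are as $j\to\infty$, with constants that may depend on $f$, $p$ and the wavelet basis but not on $j$. *)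

theory Defs
  imports "HOL-Analysis.Analysis" "HOL-Library.Landau_Symbols"
begin

text \<open>
  Elements are functions rather than classes modulo equality almost everywhere. Outside
  \<open>Lp_space p\<close> the value of \<open>Lp_norm p\<close> carries no information, since the Bochner integral of a
  non-integrable function is \<open>0\<close>.
\<close>

definition Lp_space :: "real \<Rightarrow> (real \<Rightarrow> 'a::real_normed_vector) set" where
  "Lp_space p = {f \<in> borel_measurable lborel. integrable lborel (\<lambda>x. norm (f x) powr p)}"

definition Lp_norm :: "real \<Rightarrow> (real \<Rightarrow> 'a::real_normed_vector) \<Rightarrow> real" where
  "Lp_norm p f = (LINT x|lborel. norm (f x) powr p) powr (1 / p)"

definition L2_inner :: "(real \<Rightarrow> complex) \<Rightarrow> (real \<Rightarrow> complex) \<Rightarrow> complex" where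
  "L2_inner f g = (LINT x|lborel. f x * cnj (g x))"

definition L2_closed_subspace :: "(real \<Rightarrow> complex) set \<Rightarrow> bool" where
  "L2_closed_subspace U \<longleftrightarrow>
     U \<subseteq> Lp_space 2 \<and>
     (\<lambda>x. 0) \<in> U \<and>
     (\<forall>f\<in>U. \<forall>g\<in>U. (\<lambda>x. f x + g x) \<in> U) \<and>
     (\<forall>c. \<forall>f\<in>U. (\<lambda>x. c * f x) \<in> U) \<and>
     (\<forall>F. \<forall>f\<in>Lp_space 2.
        (\<forall>n. F n \<in> U) \<and> (\<lambda>n::nat. Lp_norm 2 (\<lambda>x. F n x - f x)) \<longlonglongrightarrow> 0 \<longrightarrow> f \<in> U)"

definition L2_orthonormal_basis :: "('i \<Rightarrow> real \<Rightarrow> complex) \<Rightarrow> (real \<Rightarrow> complex) set \<Rightarrow> bool" where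
  "L2_orthonormal_basis e U \<longleftrightarrow>
     (\<forall>k. e k \<in> U) \<and>
     (\<forall>k l. L2_inner (e k) (e l) = (if k = l then 1 else 0)) \<and>
     (\<forall>f\<in>U. \<forall>\<epsilon>>0. \<exists>K c. finite K \<and> Lp_norm 2 (\<lambda>x. f x - (\<Sum>k\<in>K. c k * e k x)) < \<epsilon>)"

text \<open>
  \<open>G i\<close> is the \<open>i\<close>-th derivative of \<open>f\<close> on \<open>I\<close>; it is one-sided at the endpoints of \<open>I\<close> that belong
  to \<open>I\<close>. Meant for nondegenerate intervals.
\<close>

definition Ck_on :: "nat \<Rightarrow> real set \<Rightarrow> (real \<Rightarrow> 'a::real_normed_vector) \<Rightarrow> bool" where
  "Ck_on k I f \<longleftrightarrow>
     (\<exists>G. (\<forall>x\<in>I. G 0 x = f x) \<and>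
          (\<forall>i<k. \<forall>x\<in>I. (G i has_vector_derivative G (Suc i) x) (at x within I)) \<and>
          continuous_on I (G k))"

definition Ck_extends :: "nat \<Rightarrow> real set \<Rightarrow> (real \<Rightarrow> 'a::real_normed_vector) \<Rightarrow> bool" where
  "Ck_extends k I f \<longleftrightarrow> (\<exists>g. Ck_on k I g \<and> (\<forall>x\<in>interior I. g x = f x))"

definition multiresolution_analysis ::
    "(int \<Rightarrow> (real \<Rightarrow> complex) set) \<Rightarrow> (real \<Rightarrow> complex) \<Rightarrow> bool" where
  "multiresolution_analysis V \<phi> \<longleftrightarrow>
     (\<forall>j. L2_closed_subspace (V j)) \<and>
     (\<forall>j. V j \<subseteq> V (j + 1)) \<and>
     (\<forall>f. (\<forall>j. f \<in> V j) \<longrightarrow> (AE x in lborel. f x = 0)) \<and>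
     (\<forall>f\<in>Lp_space 2. \<forall>\<epsilon>>0. \<exists>j. \<exists>g\<in>V j. Lp_norm 2 (\<lambda>x. f x - g x) < \<epsilon>) \<and>
     (\<forall>j f. f \<in> V j \<longleftrightarrow> (\<lambda>x. f (2 * x)) \<in> V (j + 1)) \<and>
     L2_orthonormal_basis (\<lambda>(k::int) x. \<phi> (x - of_int k)) (V 0)"

definition detail_space :: "(int \<Rightarrow> (real \<Rightarrow> complex) set) \<Rightarrow> (real \<Rightarrow> complex) set" where
  "detail_space V = {f \<in> V 1. \<forall>g\<in>V 0. L2_inner f g = 0}"

text \<open>
  \<open>L\<^sup>2(\<real>)\<close> is the complex Hilbert space, so the scaling function \<open>\<phi>\<close> may be complex-valued; the
  wavelet \<open>\<psi>\<close> is real-valued. The natural numbers \<open>S\<close> and \<open>d\<close> stand for \<open>S(r)\<close> and \<open>d(r)\<close>.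
\<close>

definition regular_wavelet_basis ::
    "nat \<Rightarrow> (real \<Rightarrow> complex) \<Rightarrow> (real \<Rightarrow> real) \<Rightarrow> nat \<Rightarrow> nat \<Rightarrow> bool" where
  "regular_wavelet_basis r \<phi> \<psi> S d \<longleftrightarrow>
     r \<ge> 1 \<and>
     (\<exists>V. multiresolution_analysis V \<phi> \<and>
          L2_orthonormal_basis (\<lambda>(k::int) x. complex_of_real (\<psi> (x - of_int k))) (detail_space V)) \<and>
     Ck_on r UNIV \<phi> \<and> Ck_on r UNIV \<psi> \<and>
     compact (closure (support_on UNIV \<phi>)) \<and>
     closure (support_on UNIV \<psi>) = {0..real S} \<and>
     d \<ge> r \<and>
     (\<forall>k\<le>d. (LINT x|lborel. x ^ k * \<psi> x) = 0) \<and>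
     (LINT x|lborel. x ^ (d + 1) * \<psi> x) \<noteq> 0"

definition wavelet :: "(real \<Rightarrow> real) \<Rightarrow> nat \<Rightarrow> int \<Rightarrow> real \<Rightarrow> real" where
  "wavelet \<psi> j k x = 2 powr (real j / 2) * \<psi> (2 ^ j * x - of_int k)"

definition wavelet_kernel :: "(real \<Rightarrow> real) \<Rightarrow> nat \<Rightarrow> real \<Rightarrow> real \<Rightarrow> real" where
  "wavelet_kernel \<psi> j x y = (\<Sum>\<^sub>\<infinity>k\<in>UNIV. wavelet \<psi> j k x * wavelet \<psi> j k y)"

definition detail_operator :: "(real \<Rightarrow> real) \<Rightarrow> nat \<Rightarrow> (real \<Rightarrow> real) \<Rightarrow> real \<Rightarrow> real" where
  "detail_operator \<psi> j f x = (LINT y|lborel. wavelet_kernel \<psi> j x y * f y)"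

definition Psi0 :: "(real \<Rightarrow> real) \<Rightarrow> real" where
  "Psi0 \<psi> = (SUP x. \<Sum>\<^sub>\<infinity>k\<in>(UNIV::int set). \<bar>\<psi> (x - of_int k)\<bar>)"

definition Psi1 :: "(real \<Rightarrow> real) \<Rightarrow> nat \<Rightarrow> real \<Rightarrow> real" where
  "Psi1 \<psi> d \<delta> = Min ((\<lambda>n. \<bar>LINT u:{0..\<delta>}|lborel. (\<delta> - u) ^ n * \<psi> u\<bar>) ` {0..d})"

definition Psi2 :: "(real \<Rightarrow> real) \<Rightarrow> real" where
  "Psi2 \<psi> = (SUP x. \<bar>\<psi> x\<bar>)"

definition deriv_left :: "nat \<Rightarrow> (real \<Rightarrow> real) \<Rightarrow> real \<Rightarrow> real" where
  "deriv_left m f a = Lim (at_left a) ((deriv ^^ m) f)"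

definition deriv_right :: "nat \<Rightarrow> (real \<Rightarrow> real) \<Rightarrow> real \<Rightarrow> real" where
  "deriv_right m f a = Lim (at_right a) ((deriv ^^ m) f)"

text \<open>The list \<open>as\<close> enumerates the defect points in increasing order.\<close>

definition piecewise_smooth :: "(real \<Rightarrow> real) \<Rightarrow> nat \<Rightarrow> real list \<Rightarrow> bool" where
  "piecewise_smooth f m as \<longleftrightarrow>
     (m \<ge> 1 \<longrightarrow> Ck_on (m - 1) UNIV f) \<and>
     sorted_wrt (<) as \<and>
     (\<exists>a\<in>set as. deriv_left m f a \<noteq> deriv_right m f a) \<and>
     Ck_extends (m + 1) {..hd as} f \<and>
     (\<forall>i. Suc i < length as \<longrightarrow> Ck_extends (m + 1) {as ! i..as ! Suc i} f) \<and>
     Ck_extends (m + 1) {last as..} f"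

definition pw_index :: "(real \<Rightarrow> real) \<Rightarrow> nat" where
  "pw_index f = (THE m. \<exists>as. piecewise_smooth f m as)"

definition class_S :: "nat \<Rightarrow> real \<Rightarrow> real \<Rightarrow> nat \<Rightarrow> (real \<Rightarrow> real) set" where
  "class_S d \<Delta>1 \<Delta>2 N\<^sub>S =
     {f. closure (support_on UNIV f) \<subseteq> {-1..1} \<and>
         (\<exists>m as. piecewise_smooth f m as \<and> m \<le> d \<and>
            (\<forall>a\<in>set as. \<Delta>1 \<le> \<bar>deriv_left m f a - deriv_right m f a\<bar> \<and>
                         \<bar>deriv_left m f a - deriv_right m f a\<bar> \<le> \<Delta>2) \<and>
            length as \<le> N\<^sub>S)}"

text \<open>The index is unique, so \<open>pw_index\<close> is well defined on piecewise-smooth functions.\<close>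

lemma Ck_on_UNIV_continuous_higher_deriv:
  fixes f :: "real \<Rightarrow> real"
  assumes "Ck_on k UNIV f" "i \<le> k"
  shows "continuous_on UNIV ((deriv ^^ i) f)"
proof -
  obtain G where G0: "\<And>x. G 0 x = f x"
    and GS: "\<And>i x. i < k \<Longrightarrow> (G i has_vector_derivative G (Suc i) x) (at x)"
    and Gk: "continuous_on UNIV (G k)"
    using assms(1) unfolding Ck_on_def by auto
  have eq: "G l = (deriv ^^ l) f" if "l \<le> k" for l
    using that
  proof (induction l)
    case 0
    then show ?case using G0 by auto
  next
    case (Suc l)
    then have "(G l has_real_derivative G (Suc l) x) (at x)" for x
      using GS[of l x] by (simp add: has_real_derivative_iff_has_vector_derivative)
    then have "G (Suc l) = deriv (G l)"
      by (intro ext) (metis DERIV_imp_deriv)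
    then show ?case using Suc by simp
  qed
  show ?thesis
  proof (cases "i = k")
    case True
    then show ?thesis using Gk eq[of k] by simp
  next
    case False
    then have "continuous_on UNIV (G i)"
      using GS[of i] assms(2) by (intro continuous_on_vector_derivative[where f' = "G (Suc i)"]) auto
    then show ?thesis using eq assms(2) by simp
  qed
qed

lemma piecewise_smooth_index_le:
  assumes "piecewise_smooth f m as" "piecewise_smooth f m' bs"
  shows "m' \<le> m"
proof (rule ccontr)
  assume "\<not> m' \<le> m"
  then have c: "continuous_on UNIV ((deriv ^^ m) f)"
    using assms(2) unfolding piecewise_smooth_def
    by (auto intro!: Ck_on_UNIV_continuous_higher_deriv[of "m' - 1"])
  have "((deriv ^^ m) f \<longlongrightarrow> (deriv ^^ m) f a) (at a)" for a
    using c by (simp add: continuous_on_def)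
  then have "deriv_left m f a = deriv_right m f a" for a
    unfolding deriv_left_def deriv_right_def
    by (metis tendsto_Lim trivial_limit_at_left_real trivial_limit_at_right_real
        filterlim_at_split)
  then show False
    using assms(1) unfolding piecewise_smooth_def by auto
qed

lemma pw_index_eq:
  assumes "piecewise_smooth f m as"
  shows "pw_index f = m"
  unfolding pw_index_def
  using assms piecewise_smooth_index_le by (blast intro: the_equality le_antisym)

end

theory Submission
  imports Defs
begin

text \<open>
  Put \<open>c\<^sub>k = \<integral> f ((u + k) / 2\<^sup>j) \<psi>(u) du\<close>. Then \<open>Q\<^sub>j f\<close> is the finite sum of the
  \<open>c\<^sub>k \<psi>(2\<^sup>j x - k)\<close>, and everything rests on knowing the size of the coefficients \<open>c\<^sub>k\<close>.

  The wavelet annihilates polynomials of degree at most \<open>d\<close>, hence of degree at most \<open>m\<close>. If the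
  support of the \<open>k\<close>-th wavelet has no defect point in its interior, then \<open>f\<close> is there a Taylor
  polynomial of degree \<open>m\<close> up to \<open>O(2\<^bsup>-j(m+1)\<^esup>)\<close>, so \<open>c\<^sub>k\<close> is of that order. For large \<open>j\<close> the
  only other possibility is a single defect point \<open>a\<close>. The one-sided Taylor polynomials of \<open>f\<close> at
  \<open>a\<close> agree up to order \<open>m - 1\<close> because \<open>f\<close> is of class \<open>C\<^bsup>m-1\<^esup>\<close>, and in order \<open>m\<close> they
  differ by the jump \<open>J\<close> of the \<open>m\<close>-th derivative. Thus \<open>f(y)\<close> is a polynomial plus
  \<open>J/m! (y - a)\<^sub>+\<^sup>m\<close> plus \<open>O(2\<^bsup>-j(m+1)\<^esup>)\<close> (lemma \<open>piecewise_smooth_local_expansion\<close>), and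
  integrating against the wavelet gives (lemma \<open>wavelet_coeff_estimates\<close>), with \<open>s = 2\<^sup>j a - k\<close>,
  \<open>c\<^sub>k = J / (m! 2\<^bsup>jm\<^esup>) \<integral> (u - s)\<^sub>+\<^sup>m \<psi>(u) du + O(2\<^bsup>-j(m+1)\<^esup>)\<close>.

  Upper bound. At most \<open>S\<close> wavelets per defect point see that defect, so there are at most \<open>S N\<^sub>S\<close>
  large coefficients, and the integral in the formula is at most \<open>\<Psi>\<^sub>2 S\<^bsup>m+1\<^esup> / (m + 1)\<close>. The
  pointwise bound \<open>\<Psi>\<^sub>0\<close> for a sum of translates turns the number of coefficients into an
  \<open>L\<^sup>p\<close> norm (lemma \<open>synthesis_powr_bound\<close>). The remaining \<open>O(2\<^sup>j)\<close> coefficients, all of order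
  \<open>2\<^bsup>-j(m+1)\<^esup>\<close>, contribute the error term, and Minkowski's inequality adds the two parts.

  Lower bound. By orthonormality \<open>c\<^sub>k\<close> is recovered from \<open>Q\<^sub>j f\<close> by integration against the \<open>k\<close>-th
  wavelet, so by Hoelder's inequality one large coefficient makes the norm large
  (lemma \<open>synthesis_Lp_lower_bound\<close>). Fix a defect point \<open>a\<close> and choose \<open>k\<close> with
  \<open>s\<close> in \<open>[\<delta>\<^sub>1, 1 + \<delta>\<^sub>1)\<close>. The vanishing moments give
  \<open>\<bar>\<integral> (u - s)\<^sub>+\<^sup>m \<psi>(u) du\<bar> = \<bar>\<integral>\<^sub>0\<^sup>s (s - u)\<^sup>m \<psi>(u) du\<bar>\<close>, and since \<open>\<psi>\<close> has constant sign
  on \<open>(0, 1 + \<delta>\<^sub>1]\<close> this increases with \<open>s\<close>; at \<open>s = \<delta>\<^sub>1\<close> it is at least \<open>\<Psi>\<^sub>1\<close>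
  (lemma \<open>Psi1_le_jump_moment\<close>).
\<close>

section \<open>Convexity inequalities for integrals of powers\<close>

text \<open>
  The power function is convex on the open half-line; the boundary cases where \<open>x\<close> or \<open>y\<close>
  vanishes reduce to \<open>s\<^sup>p \<le> s\<close> for \<open>s\<close> in \<open>[0, 1]\<close>.
\<close>

lemma powr_convex_combination_le:
  fixes x y t p :: real
  assumes "p \<ge> 1" "x \<ge> 0" "y \<ge> 0" "0 \<le> t" "t \<le> 1"
  shows "((1 - t) * x + t * y) powr p \<le> (1 - t) * x powr p + t * y powr p"
proof -
  have scale: "(s * z) powr p \<le> s * z powr p" if "0 \<le> s" "s \<le> 1" "z \<ge> 0" for s z :: real
  proof -
    have "s powr p \<le> s"
      using powr_mono'[of 1 p s] that assms(1) by simp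
    then show ?thesis
      using that by (simp add: powr_mult mult_right_mono)
  qed
  consider "x = 0" | "y = 0" | "x > 0" "y > 0"
    using assms by fastforce
  then show ?thesis
  proof cases
    case 1
    then show ?thesis using scale[of t y] assms by simp
  next
    case 2
    then show ?thesis using scale[of "1 - t" x] assms by simp
  next
    case 3
    then show ?thesis
      using convex_onD[OF powr_convex[OF assms(1)], of t x y] assms by simp
  qed
qed

text \<open>
  Minkowski's inequality in terms of upper bounds \<open>A\<close> and \<open>B\<close> for the two norms. Strict positivity
  of the bounds makes it possible to divide by them: \<open>(g + h) / (A + B)\<close> is a convex combination
  of \<open>g / A\<close> and \<open>h / B\<close>, and convexity of the power is integrated pointwise.
\<close>

lemma Minkowski_bound:
  fixes g h :: "real \<Rightarrow> real"
  assumes p: "p \<ge> 1" and AB: "A > 0" "B > 0"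
    and [measurable]: "g \<in> borel_measurable lborel" "h \<in> borel_measurable lborel"
    and nn: "\<And>x. g x \<ge> 0" "\<And>x. h x \<ge> 0"
    and ig: "integrable lborel (\<lambda>x. g x powr p)" and ih: "integrable lborel (\<lambda>x. h x powr p)"
    and bg: "(LINT x|lborel. g x powr p) \<le> A powr p"
    and bh: "(LINT x|lborel. h x powr p) \<le> B powr p"
  shows "integrable lborel (\<lambda>x. (g x + h x) powr p)"
    and "(LINT x|lborel. (g x + h x) powr p) \<le> (A + B) powr p"
proof -
  \<comment> \<open>the weight for which \<open>(1 - t) / A = t / B = 1 / (A + B)\<close>\<close>
  define t where "t = B / (A + B)"
  have t: "0 \<le> t" "t \<le> 1" "1 - t = A / (A + B)"
    using AB by (auto simp: t_def field_simps)
  define W where "W x = (A + B) powr p * ((1 - t) * (g x powr p / A powr p) + t * (h x powr p / B powr p))" for x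
  have pw: "(g x + h x) powr p \<le> W x" for x
  proof -
    have "g x + h x = (A + B) * ((1 - t) * (g x / A) + t * (h x / B))"
      using AB unfolding t(3) by (simp add: t_def distrib_left)
    also have "\<dots> powr p = (A + B) powr p * ((1 - t) * (g x / A) + t * (h x / B)) powr p"
      by (simp add: powr_mult)
    also have "\<dots> \<le> W x"
      unfolding W_def
      using powr_convex_combination_le[OF p, of "g x / A" "h x / B" t] AB nn[of x] t
      by (intro mult_left_mono) (auto simp: powr_divide)
    finally show ?thesis .
  qed
  have iW: "integrable lborel W"
    unfolding W_def using ig ih by (intro integrable_mult_right Bochner_Integration.integrable_add integrable_divide_zero) auto
  show i: "integrable lborel (\<lambda>x. (g x + h x) powr p)"
    by (rule Bochner_Integration.integrable_bound[OF iW]) (use pw order_trans[OF pw] in \<open>auto intro: order_trans[OF pw]\<close>)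
  have "(LINT x|lborel. (g x + h x) powr p) \<le> (LINT x|lborel. W x)"
    by (intro integral_mono i iW pw)
  also have "\<dots> = (A + B) powr p * ((1 - t) * ((LINT x|lborel. g x powr p) / A powr p) + t * ((LINT x|lborel. h x powr p) / B powr p))"
    unfolding W_def using ig ih by simp
  also have "\<dots> \<le> (A + B) powr p * ((1 - t) * 1 + t * 1)"
    using bg bh AB t by (intro mult_left_mono add_mono) (auto simp: divide_simps)
  finally show "(LINT x|lborel. (g x + h x) powr p) \<le> (A + B) powr p" by simp
qed

text \<open>
  As with Minkowski's inequality, positive upper bounds for the norms take the place of the norms,
  so Young's inequality can be applied to \<open>F / A\<close> and \<open>G / B\<close>.
\<close>

lemma Holder_bound:
  fixes F G :: "real \<Rightarrow> real"
  assumes pq: "p > 1" "q > 1" "1 / p + 1 / q = 1" and AB: "A > 0" "B > 0"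
    and [measurable]: "F \<in> borel_measurable lborel" "G \<in> borel_measurable lborel"
    and iF: "integrable lborel (\<lambda>x. \<bar>F x\<bar> powr p)" and iG: "integrable lborel (\<lambda>x. \<bar>G x\<bar> powr q)"
    and bF: "(LINT x|lborel. \<bar>F x\<bar> powr p) \<le> A powr p"
    and bG: "(LINT x|lborel. \<bar>G x\<bar> powr q) \<le> B powr q"
  shows "\<bar>LINT x|lborel. F x * G x\<bar> \<le> A * B"
proof -
  define W where "W x = A * B * ((\<bar>F x\<bar> powr p / A powr p) / p + (\<bar>G x\<bar> powr q / B powr q) / q)" for x
  have pw: "\<bar>F x * G x\<bar> \<le> W x" for x
  proof -
    have "(\<bar>F x\<bar> / A) * (\<bar>G x\<bar> / B) \<le> (\<bar>F x\<bar> / A) powr p / p + (\<bar>G x\<bar> / B) powr q / q"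
      using pq AB by (intro Youngs_inequality) auto
    then have "A * B * ((\<bar>F x\<bar> / A) * (\<bar>G x\<bar> / B)) \<le> W x"
      unfolding W_def using AB by (intro mult_left_mono) (auto simp: powr_divide)
    then show ?thesis using AB by (simp add: abs_mult)
  qed
  have iW: "integrable lborel W"
    unfolding W_def using iF iG
    by (intro integrable_mult_right Bochner_Integration.integrable_add integrable_divide_zero) auto
  have "\<bar>LINT x|lborel. F x * G x\<bar> \<le> (LINT x|lborel. \<bar>F x * G x\<bar>)"
    by (rule integral_abs_bound)
  also have "\<dots> \<le> (LINT x|lborel. W x)"
    using pw by (intro integral_mono_AE' iW) (auto intro: order_trans[OF abs_ge_zero pw])
  also have "\<dots> = A * B * (((LINT x|lborel. \<bar>F x\<bar> powr p) / A powr p) / p + ((LINT x|lborel. \<bar>G x\<bar> powr q) / B powr q) / q)"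
    unfolding W_def using iF iG by simp
  also have "\<dots> \<le> A * B * (1 / p + 1 / q)"
    using bF bG AB pq by (intro mult_left_mono add_mono divide_right_mono) (auto simp: divide_simps)
  finally show ?thesis using pq by simp
qed

section \<open>Expansion of a piecewise-smooth function near a defect point\<close>

lemma finite_real_separation:
  fixes A :: "real set"
  assumes "finite A"
  obtains \<rho> where "\<rho> > 0" "\<And>a b. a \<in> A \<Longrightarrow> b \<in> A \<Longrightarrow> a \<noteq> b \<Longrightarrow> \<rho> \<le> \<bar>a - b\<bar>"
proof -
  have "\<forall>a\<in>A. \<exists>\<delta>>0. \<forall>x\<in>A. x \<noteq> a \<longrightarrow> \<delta> \<le> dist a x"
    using finite_set_avoid[OF assms] by blast
  then obtain \<delta> where \<delta>: "\<And>a. a \<in> A \<Longrightarrow> \<delta> a > 0"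
    "\<And>a x. a \<in> A \<Longrightarrow> x \<in> A \<Longrightarrow> x \<noteq> a \<Longrightarrow> \<delta> a \<le> dist a x"
    by metis
  show ?thesis
  proof (rule that)
    show "Min (insert 1 (\<delta> ` A)) > 0" using assms \<delta>(1) by simp
    fix a b assume "a \<in> A" "b \<in> A" "a \<noteq> b"
    then show "Min (insert 1 (\<delta> ` A)) \<le> \<bar>a - b\<bar>"
      using assms \<delta>(2)[of a b] by (intro order_trans[OF Min_le, of _ "\<delta> a"]) (auto simp: dist_real_def)
  qed
qed

text \<open>
  \<open>G 0\<close> is the smooth extension of \<open>f\<close> from the interior of \<open>I\<close> to \<open>I\<close>, and \<open>G i\<close> its \<open>i\<close>-th
  derivative for \<open>i \<le> m + 1\<close>, one-sided at the endpoints. The last clause ties the chain to the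
  iterated derivatives by which the jumps of \<open>f\<close> are defined.
\<close>

definition derivative_chain :: "nat \<Rightarrow> real set \<Rightarrow> (real \<Rightarrow> real) \<Rightarrow> (nat \<Rightarrow> real \<Rightarrow> real) \<Rightarrow> bool" where
  "derivative_chain m I f G \<longleftrightarrow>
     (\<forall>i\<le>m. \<forall>x\<in>I. (G i has_real_derivative G (Suc i) x) (at x within I)) \<and>
     continuous_on I (G (Suc m)) \<and>
     (\<forall>i\<le>m. \<forall>x\<in>interior I. (deriv ^^ i) f x = G i x)"

lemma Ck_extends_derivative_chain:
  assumes "Ck_extends (Suc m) I f"
  obtains G where "derivative_chain m I f G"
proof -
  obtain g where g: "Ck_on (Suc m) I g" and gf: "\<And>x. x \<in> interior I \<Longrightarrow> g x = f x"
    using assms unfolding Ck_extends_def by blast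
  obtain G where chain: "\<forall>x\<in>I. G 0 x = g x"
    "\<forall>i<Suc m. \<forall>x\<in>I. (G i has_vector_derivative G (Suc i) x) (at x within I)"
    and Gc: "continuous_on I (G (Suc m))"
    using g unfolding Ck_on_def by blast
  have G0: "G 0 x = g x" if "x \<in> I" for x
    using chain(1) that by blast
  have GS: "(G i has_real_derivative G (Suc i) x) (at x within I)" if "i \<le> m" "x \<in> I" for i x
    using chain(2) that by (simp add: has_real_derivative_iff_has_vector_derivative)
  have "\<forall>x\<in>interior I. (deriv ^^ i) f x = G i x" if "i \<le> m" for i
    using that
  proof (induction i)
    case 0
    then show ?case using gf G0 interior_subset by (metis funpow_0 subsetD)
  next
    case (Suc i)
    show ?case
    proof
      fix x assume x: "x \<in> interior I"
      have "(G i has_real_derivative G (Suc i) x) (at x)"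
        using GS[of i x] x Suc.prems interior_subset at_within_interior[OF x] by (metis Suc_leD subsetD)
      then have "((deriv ^^ i) f has_real_derivative G (Suc i) x) (at x)"
        by (rule has_field_derivative_transform_within_open[OF _ open_interior x])
           (use Suc in auto)
      then show "(deriv ^^ Suc i) f x = G (Suc i) x"
        by (simp add: DERIV_imp_deriv)
    qed
  qed
  then have "derivative_chain m I f G"
    unfolding derivative_chain_def using GS Gc by blast
  then show ?thesis by (rule that)
qed

lemma derivative_chainD:
  assumes "derivative_chain m I f G" "i \<le> m"
  shows "x \<in> I \<Longrightarrow> (G i has_real_derivative G (Suc i) x) (at x within I)"
  using assms by (simp add: derivative_chain_def)

lemma derivative_chain_continuous:
  assumes "derivative_chain m I f G" "i \<le> m"
  shows "continuous_on I (G i)"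
  by (rule DERIV_continuous_on[where D = "G (Suc i)"]) (rule derivative_chainD[OF assms])

text \<open>
  Continuity of \<open>G i\<close> up to the endpoint identifies the one-sided limits of the derivatives of \<open>f\<close>
  at a defect point with values of the chain.
\<close>

lemma derivative_chain_tendsto_left:
  assumes G: "derivative_chain m I f G" and i: "i \<le> m" and ab: "b < a" "{b..a} \<subseteq> I"
  shows "((deriv ^^ i) f \<longlongrightarrow> G i a) (at_left a)"
proof -
  have "(G i \<longlongrightarrow> G i a) (at a within {b..a})"
    using continuous_on_subset[OF derivative_chain_continuous[OF G i] ab(2)] ab
    by (simp add: continuous_on_def)
  then have "(G i \<longlongrightarrow> G i a) (at_left a)"
    using ab by (simp add: at_within_Icc_at_left)
  moreover have "{b<..<a} \<subseteq> interior I"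
    using interior_mono[OF ab(2)] by simp
  then have "\<forall>\<^sub>F x in at_left a. G i x = (deriv ^^ i) f x"
    using G i ab unfolding derivative_chain_def
    by (intro eventually_at_leftI[of b]) auto
  ultimately show ?thesis by (rule Lim_transform_eventually)
qed

lemma derivative_chain_tendsto_right:
  assumes G: "derivative_chain m I f G" and i: "i \<le> m" and ab: "a < b" "{a..b} \<subseteq> I"
  shows "((deriv ^^ i) f \<longlongrightarrow> G i a) (at_right a)"
proof -
  have "(G i \<longlongrightarrow> G i a) (at a within {a..b})"
    using continuous_on_subset[OF derivative_chain_continuous[OF G i] ab(2)] ab
    by (simp add: continuous_on_def)
  then have "(G i \<longlongrightarrow> G i a) (at_right a)"
    using ab by (simp add: at_within_Icc_at_right)
  moreover have "{a<..<b} \<subseteq> interior I"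
    using interior_mono[OF ab(2)] by simp
  then have "\<forall>\<^sub>F x in at_right a. G i x = (deriv ^^ i) f x"
    using G i ab unfolding derivative_chain_def
    by (intro eventually_at_rightI[of _ b]) auto
  ultimately show ?thesis by (rule Lim_transform_eventually)
qed

text \<open>
  Truncating to \<open>[-R, R]\<close> makes the derivative of order \<open>m + 1\<close> bounded, even on the two unbounded
  pieces. The constant is uniform in the expansion point, which may be an endpoint of \<open>I\<close>.
\<close>

lemma derivative_chain_Taylor:
  assumes G: "derivative_chain m I f G" and I: "closed I" "convex I"
  shows "\<exists>C\<ge>0. \<forall>y\<in>I \<inter> {-R..R}. \<forall>z\<in>I \<inter> {-R..R}.
           \<bar>G 0 z - (\<Sum>i\<le>m. G i y / fact i * (z - y) ^ i)\<bar> \<le> C * \<bar>z - y\<bar> ^ Suc m"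
proof -
  have "compact (G (Suc m) ` (I \<inter> {-R..R}))"
    using G I unfolding derivative_chain_def
    by (intro compact_continuous_image closed_Int_compact) (auto intro: continuous_on_subset)
  then obtain B where B: "\<And>x. x \<in> I \<inter> {-R..R} \<Longrightarrow> norm (G (Suc m) x) \<le> B"
    by (meson bounded_iff compact_imp_bounded imageI)
  have "\<bar>G 0 z - (\<Sum>i\<le>m. G i y / fact i * (z - y) ^ i)\<bar> \<le> max B 0 / fact m * \<bar>z - y\<bar> ^ Suc m"
    if yz: "y \<in> I \<inter> {-R..R}" "z \<in> I \<inter> {-R..R}" for y z
  proof -
    have "norm (G 0 z - (\<Sum>i\<le>m. G i y * (z - y) ^ i / fact i)) \<le> max B 0 * norm (z - y) ^ Suc m / fact m"
    proof (rule field_Taylor[where S = "I \<inter> {-R..R}"])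
      fix i x assume "x \<in> I \<inter> {-R..R}" "i \<le> m"
      then show "(G i has_field_derivative G (Suc i) x) (at x within I \<inter> {-R..R})"
        by (intro has_field_derivative_subset[OF derivative_chainD[OF G]]) auto
    next
      show "convex (I \<inter> {-R..R})" using I by (intro convex_Int) auto
    next
      fix x assume "x \<in> I \<inter> {-R..R}"
      then show "norm (G (Suc m) x) \<le> max B 0" using B[of x] by linarith
    qed (use yz in auto)
    then show ?thesis by (simp del: power_Suc)
  qed
  then show ?thesis by (intro exI[of _ "max B 0 / fact m"]) auto
qed

definition pieces :: "real list \<Rightarrow> real set set" where
  "pieces as = {{..hd as}, {last as..}} \<union> (\<lambda>i. {as ! i..as ! Suc i}) ` {i. Suc i < length as}"

lemma finite_pieces: "finite (pieces as)"
proof -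
  have "finite {i. Suc i < length as}"
    by (rule finite_subset[of _ "{..<length as}"]) auto
  then show ?thesis by (simp add: pieces_def)
qed

lemma closed_convex_pieces:
  assumes "I \<in> pieces as"
  shows "closed I" "convex I"
  using assms by (auto simp: pieces_def)

lemma piecewise_smooth_pieces:
  assumes "piecewise_smooth f m as" "I \<in> pieces as"
  shows "Ck_extends (Suc m) I f"
  using assms unfolding piecewise_smooth_def pieces_def by auto

text \<open>
  The piece starts at the last defect point that is not to the right of \<open>b\<close>, unless the interval
  lies to one side of all defect points.
\<close>

lemma defect_free_in_piece:
  assumes as: "sorted_wrt (<) as" "as \<noteq> []" and bc: "b < c" "{b<..<c} \<inter> set as = {}"
  obtains I where "I \<in> pieces as" "{b..c} \<subseteq> I"
proof (cases "c \<le> hd as \<or> last as \<le> b")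
  case True
  then show ?thesis
    using that[of "{..hd as}"] that[of "{last as..}"] by (auto simp: pieces_def)
next
  case False
  have out: "a \<le> b \<or> c \<le> a" if "a \<in> set as" for a
    using bc that by (meson disjoint_iff greaterThanLessThan_iff not_le)
  define J where "J = {i. i < length as \<and> as ! i \<le> b}"
  have fin: "finite J" unfolding J_def by simp
  have "0 \<in> J"
    using False out[of "hd as"] as(2) by (auto simp: J_def hd_conv_nth)
  then have i: "Max J \<in> J" using fin by (intro Max_in) auto
  have suc: "Suc (Max J) < length as"
  proof (rule ccontr)
    assume "\<not> ?thesis"
    then have "Max J = length as - 1" using i by (auto simp: J_def)
    then show False using i False as(2) by (auto simp: J_def last_conv_nth)
  qed
  have "as ! Suc (Max J) \<ge> c"
  proof (rule ccontr)
    assume "\<not> ?thesis"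
    then have "as ! Suc (Max J) \<le> b"
      using out[of "as ! Suc (Max J)"] suc by auto
    then have "Suc (Max J) \<in> J" using suc by (simp add: J_def)
    then show False using Max_ge[OF fin, of "Suc (Max J)"] by simp
  qed
  then show ?thesis
    using i suc by (intro that[of "{as ! Max J..as ! Suc (Max J)}"]) (auto simp: pieces_def J_def)
qed

lemma piecewise_smooth_nonempty: "piecewise_smooth f m as \<Longrightarrow> as \<noteq> []"
  unfolding piecewise_smooth_def by auto

lemma piecewise_smooth_chains:
  assumes "piecewise_smooth f m as"
  obtains G where "\<forall>I\<in>pieces as. derivative_chain m I f (G I)"
proof -
  have "\<forall>I\<in>pieces as. \<exists>G. derivative_chain m I f G"
    using piecewise_smooth_pieces[OF assms] Ck_extends_derivative_chain by metis
  then show ?thesis using that by metis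
qed

lemma non_defect_in_piece_interior:
  assumes ps: "piecewise_smooth f m as" and y: "y \<notin> set as"
  obtains I where "I \<in> pieces as" "y \<in> interior I"
proof -
  obtain \<delta> where \<delta>: "\<delta> > 0" "\<forall>x\<in>set as. x \<noteq> y \<longrightarrow> \<delta> \<le> dist y x"
    using finite_set_avoid[of "set as" y] by blast
  have "x \<notin> {y - \<delta><..<y + \<delta>}" if "x \<in> set as" for x
  proof -
    have "\<delta> \<le> \<bar>y - x\<bar>" using \<delta>(2) that y unfolding dist_real_def by metis
    then show ?thesis by auto
  qed
  then have "{y - \<delta><..<y + \<delta>} \<inter> set as = {}" by blast
  then obtain I where I: "I \<in> pieces as" "{y - \<delta>..y + \<delta>} \<subseteq> I"
    using ps \<delta>(1) defect_free_in_piece[of as "y - \<delta>" "y + \<delta>"] piecewise_smooth_nonempty[OF ps]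
    unfolding piecewise_smooth_def by auto
  have "y \<in> interior I"
    using interior_mono[OF I(2)] \<delta>(1) by auto
  then show ?thesis using I(1) that by blast
qed

lemma piecewise_smooth_measurable:
  assumes ps: "piecewise_smooth f m as"
  shows "f \<in> borel_measurable borel"
proof (rule borel_measurable_continuous_countable_exceptions)
  show "countable (set as)" by (simp add: countable_finite)
  show "continuous_on (- set as) f"
  proof (intro continuous_at_imp_continuous_on ballI)
    fix y assume "y \<in> - set as"
    then obtain I where I: "I \<in> pieces as" "y \<in> interior I"
      using non_defect_in_piece_interior[OF ps] by auto
    obtain G where G: "derivative_chain m I f G"
      using Ck_extends_derivative_chain[OF piecewise_smooth_pieces[OF ps I(1)]] .
    have "continuous_on (interior I) (G 0)"
      using continuous_on_subset[OF derivative_chain_continuous[OF G] interior_subset] by simp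
    then have "continuous_on (interior I) f"
      using G by (subst continuous_on_cong[of _ "interior I" _ "G 0"]) (auto simp: derivative_chain_def)
    then show "isCont f y"
      using I(2) by (simp add: continuous_on_eq_continuous_at)
  qed
qed

lemma piecewise_smooth_bounded:
  assumes ps: "piecewise_smooth f m as" and fs: "\<And>y. y \<notin> {-1..1} \<Longrightarrow> f y = 0"
  obtains B where "\<And>y. y \<notin> set as \<Longrightarrow> \<bar>f y\<bar> \<le> B"
proof -
  obtain G where "\<forall>I\<in>pieces as. derivative_chain m I f (G I)"
    using piecewise_smooth_chains[OF ps] .
  note G = this[rule_format]
  have "\<exists>B\<ge>0. \<forall>y\<in>I \<inter> {-1..1}. \<bar>G I 0 y\<bar> \<le> B" if I: "I \<in> pieces as" for I
  proof -
    have "compact (G I 0 ` (I \<inter> {-1..1}))"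
      using closed_convex_pieces[OF I] derivative_chain_continuous[OF G[OF I], of 0]
      by (intro compact_continuous_image closed_Int_compact) (auto intro: continuous_on_subset)
    then obtain B where B: "\<And>x. x \<in> I \<inter> {-1..1} \<Longrightarrow> norm (G I 0 x) \<le> B"
      by (meson bounded_iff compact_imp_bounded imageI)
    then show ?thesis by (intro exI[of _ "max B 0"]) (auto simp: le_max_iff_disj)
  qed
  then have "\<forall>I\<in>pieces as. \<exists>B\<ge>0. \<forall>y\<in>I \<inter> {-1..1}. \<bar>G I 0 y\<bar> \<le> B" by blast
  from bchoice[OF this] obtain B where BB: "\<forall>I\<in>pieces as. B I \<ge> 0 \<and> (\<forall>y\<in>I \<inter> {-1..1}. \<bar>G I 0 y\<bar> \<le> B I)"
    by (elim exE)
  have B: "B I \<ge> 0" "y \<in> I \<inter> {-1..1} \<Longrightarrow> \<bar>G I 0 y\<bar> \<le> B I" if "I \<in> pieces as" for I y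
    using BB that by blast+
  have "\<bar>f y\<bar> \<le> sum B (pieces as)" if nd: "y \<notin> set as" for y
  proof (cases "y \<in> {-1..1}")
    case True
    obtain I where I: "I \<in> pieces as" "y \<in> interior I"
      using non_defect_in_piece_interior[OF ps nd] .
    have "f y = G I 0 y" using G[OF I(1)] I(2) by (auto simp: derivative_chain_def)
    then have "\<bar>f y\<bar> \<le> B I" using B(2)[OF I(1), of y] I(2) True interior_subset by auto
    also have "\<dots> \<le> sum B (pieces as)" using B(1) I(1) finite_pieces by (intro member_le_sum) auto
    finally show ?thesis .
  qed (use fs B(1) in \<open>auto intro: sum_nonneg\<close>)
  then show ?thesis by (rule that)
qed

text \<open>
  At a defect point the left and the right chain agree in the orders below \<open>m\<close>, where the derivatives
  of \<open>f\<close> are continuous, and their difference in order \<open>m\<close> is the jump.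
\<close>

lemma derivative_chains_match:
  assumes ps: "piecewise_smooth f m as"
    and G: "derivative_chain m I f G" "b < a" "{b..a} \<subseteq> I"
    and H: "derivative_chain m I' f H" "a < c" "{a..c} \<subseteq> I'"
  shows "i < m \<Longrightarrow> H i a = G i a"
    and "H m a - G m a = deriv_right m f a - deriv_left m f a"
proof -
  note left = derivative_chain_tendsto_left[OF G(1) _ G(2,3)]
  note right = derivative_chain_tendsto_right[OF H(1) _ H(2,3)]
  show "H m a - G m a = deriv_right m f a - deriv_left m f a"
    unfolding deriv_left_def deriv_right_def
    using left[of m] right[of m] by (simp add: tendsto_Lim)
  assume i: "i < m"
  then have "Ck_on (m - 1) UNIV f" "i \<le> m - 1"
    using ps unfolding piecewise_smooth_def by auto
  then have "continuous_on UNIV ((deriv ^^ i) f)"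
    by (rule Ck_on_UNIV_continuous_higher_deriv)
  then have lim: "((deriv ^^ i) f \<longlongrightarrow> (deriv ^^ i) f a) (at a)"
    by (simp add: continuous_on_def)
  have "G i a = (deriv ^^ i) f a"
    using left[of i] filterlim_at_split[THEN iffD1, OF lim] i
    by (intro tendsto_unique[OF trivial_limit_at_left_real]) auto
  moreover have "H i a = (deriv ^^ i) f a"
    using right[of i] filterlim_at_split[THEN iffD1, OF lim] i
    by (intro tendsto_unique[OF trivial_limit_at_right_real]) auto
  ultimately show "H i a = G i a" by simp
qed

text \<open>
  Around a single defect point \<open>a\<close> both one-sided Taylor polynomials are centred at \<open>a\<close>. They
  differ only in the term of order \<open>m\<close>, so one polynomial serves on both sides once the truncated
  power with the jump as its coefficient has been split off.
\<close>

lemma piecewise_smooth_local_expansion: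
  assumes ps: "piecewise_smooth f m as"
  obtains C where "C > 0"
    and "\<forall>b h. h > 0 \<and> -R \<le> b \<and> b + h \<le> R \<and> {b<..<b + h} \<inter> set as = {} \<longrightarrow>
      (\<exists>c. \<forall>y\<in>{b<..<b + h}. \<bar>f y - (\<Sum>i\<le>m. c i * (y - b) ^ i)\<bar> \<le> C * h ^ Suc m)"
    and "\<forall>b h a. h > 0 \<and> -R \<le> b \<and> b + h \<le> R \<and> {b<..<b + h} \<inter> set as = {a} \<longrightarrow>
      (\<exists>c. \<forall>y\<in>{b<..<b + h} - {a}. \<bar>f y - (\<Sum>i\<le>m. c i * (y - a) ^ i)
        - (deriv_right m f a - deriv_left m f a) / fact m * (indicator {a<..} y * (y - a) ^ m)\<bar> \<le> C * h ^ Suc m)"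
proof -
  note srt = ps[unfolded piecewise_smooth_def, THEN conjunct2, THEN conjunct1]
    and ne = piecewise_smooth_nonempty[OF ps]
  obtain G where "\<forall>I\<in>pieces as. derivative_chain m I f (G I)"
    using piecewise_smooth_chains[OF ps] .
  note G = this[rule_format]
  have "\<forall>I\<in>pieces as. \<exists>C\<ge>0. \<forall>y\<in>I \<inter> {-R..R}. \<forall>z\<in>I \<inter> {-R..R}.
      \<bar>G I 0 z - (\<Sum>i\<le>m. G I i y / fact i * (z - y) ^ i)\<bar> \<le> C * \<bar>z - y\<bar> ^ Suc m"
    by (intro ballI derivative_chain_Taylor[OF G]) (simp_all add: closed_convex_pieces)
  from bchoice[OF this] obtain C where CC: "\<forall>I\<in>pieces as. C I \<ge> 0 \<and> (\<forall>y\<in>I \<inter> {-R..R}. \<forall>z\<in>I \<inter> {-R..R}.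
      \<bar>G I 0 z - (\<Sum>i\<le>m. G I i y / fact i * (z - y) ^ i)\<bar> \<le> C I * \<bar>z - y\<bar> ^ Suc m)"
    by (elim exE)
  have C0: "C I \<ge> 0" if "I \<in> pieces as" for I
    using CC that by blast
  have C: "\<bar>G I 0 z - (\<Sum>i\<le>m. G I i y / fact i * (z - y) ^ i)\<bar> \<le> C I * \<bar>z - y\<bar> ^ Suc m"
    if "I \<in> pieces as" "y \<in> I \<inter> {-R..R}" "z \<in> I \<inter> {-R..R}" for I y z
    using CC that by blast
  \<comment> \<open>one constant for all pieces; the summand \<open>1\<close> makes it positive\<close>
  define T where "T = 1 + sum C (pieces as)"
  have T: "C I \<le> T" if "I \<in> pieces as" for I
    using that C0 finite_pieces member_le_sum[of I "pieces as" C] by (auto simp: T_def)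
  have approx: "\<bar>f z - (\<Sum>i\<le>m. G I i y / fact i * (z - y) ^ i)\<bar> \<le> T * h ^ Suc m"
    if "I \<in> pieces as" "y \<in> I" "z \<in> interior I" "\<bar>y\<bar> \<le> R" "\<bar>z\<bar> \<le> R" "\<bar>z - y\<bar> \<le> h" for I y z h
  proof -
    have "f z = G I 0 z" using G[OF that(1)] that(3) by (auto simp: derivative_chain_def)
    then have "\<bar>f z - (\<Sum>i\<le>m. G I i y / fact i * (z - y) ^ i)\<bar> \<le> C I * \<bar>z - y\<bar> ^ Suc m"
    proof -
      have "y \<in> I \<inter> {-R..R}" "z \<in> I \<inter> {-R..R}"
        using that interior_subset[of I] by auto
      then show ?thesis using C[OF that(1)] \<open>f z = G I 0 z\<close> by simp
    qed
    also have "\<dots> \<le> T * h ^ Suc m"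
      using T[OF that(1)] C0[OF that(1)] that(6) by (intro mult_mono power_mono) auto
    finally show ?thesis .
  qed
  show ?thesis
  proof (rule that[OF _ allI[OF allI[OF impI]] allI[OF allI[OF allI[OF impI]]]])
    show "T > 0" unfolding T_def using C0 by (simp add: add_pos_nonneg sum_nonneg)
  next
    fix b h :: real
    assume "h > 0 \<and> -R \<le> b \<and> b + h \<le> R \<and> {b<..<b + h} \<inter> set as = {}"
    then have h: "h > 0" and R: "-R \<le> b" "b + h \<le> R" and empty: "{b<..<b + h} \<inter> set as = {}"
      by blast+
    obtain I where I: "I \<in> pieces as" "{b..b + h} \<subseteq> I"
      using defect_free_in_piece[OF srt ne _ empty] h by auto
    have "{b<..<b + h} \<subseteq> interior I" using interior_mono[OF I(2)] by simp
    then show "\<exists>c. \<forall>y\<in>{b<..<b + h}. \<bar>f y - (\<Sum>i\<le>m. c i * (y - b) ^ i)\<bar> \<le> T * h ^ Suc m"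
      using I R h by (intro exI[of _ "\<lambda>i. G I i b / fact i"] ballI approx) auto
  next
    fix b h a :: real
    assume "h > 0 \<and> -R \<le> b \<and> b + h \<le> R \<and> {b<..<b + h} \<inter> set as = {a}"
    then have h: "h > 0" and R: "-R \<le> b" "b + h \<le> R" and single: "{b<..<b + h} \<inter> set as = {a}"
      by blast+
    have a: "b < a" "a < b + h" using single by auto
    have "{b<..<a} \<inter> set as \<subseteq> {a}" "{a<..<b + h} \<inter> set as \<subseteq> {a}"
      using single a by force+
    then have free: "{b<..<a} \<inter> set as = {}" "{a<..<b + h} \<inter> set as = {}" by auto
    obtain I where I: "I \<in> pieces as" "{b..a} \<subseteq> I"
      using defect_free_in_piece[OF srt ne a(1) free(1)] .
    obtain I' where I': "I' \<in> pieces as" "{a..b + h} \<subseteq> I'"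
      using defect_free_in_piece[OF srt ne a(2) free(2)] .
    have int: "{b<..<a} \<subseteq> interior I" "{a<..<b + h} \<subseteq> interior I'"
      using interior_mono[OF I(2)] interior_mono[OF I'(2)] by simp_all
    let ?J = "deriv_right m f a - deriv_left m f a"
    note match = derivative_chains_match[OF ps G[OF I(1)] a(1) I(2) G[OF I'(1)] a(2) I'(2)]
    have "\<bar>f y - (\<Sum>i\<le>m. G I i a / fact i * (y - a) ^ i)
        - ?J / fact m * (indicator {a<..} y * (y - a) ^ m)\<bar> \<le> T * h ^ Suc m"
      if y: "y \<in> {b<..<b + h} - {a}" for y
    proof (cases "y < a")
      case True
      moreover have "a \<in> I" "y \<in> interior I" using I(2) int(1) a y True by auto
      then have "\<bar>f y - (\<Sum>i\<le>m. G I i a / fact i * (y - a) ^ i)\<bar> \<le> T * h ^ Suc m"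
        using True I(1) a R y by (intro approx) auto
      ultimately show ?thesis by simp
    next
      case False
      have "(\<Sum>i\<le>m. G I' i a / fact i * (y - a) ^ i)
          = (\<Sum>i\<le>m. G I i a / fact i * (y - a) ^ i + (if i = m then ?J / fact m * (y - a) ^ m else 0))"
      proof (intro sum.cong refl)
        fix i assume "i \<in> {..m}"
        then consider "i < m" | "i = m" by fastforce
        then show "G I' i a / fact i * (y - a) ^ i
            = G I i a / fact i * (y - a) ^ i + (if i = m then ?J / fact m * (y - a) ^ m else 0)"
        proof cases
          case 1
          then show ?thesis using match(1) by simp
        next
          case 2
          have "G I' m a = G I m a + ?J" using match(2) by simp
          then show ?thesis using 2 by (simp add: add_divide_distrib distrib_right)
        qed
      qed
      also have "\<dots> = (\<Sum>i\<le>m. G I i a / fact i * (y - a) ^ i) + ?J / fact m * (y - a) ^ m"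
        by (simp add: sum.distrib)
      finally have "(\<Sum>i\<le>m. G I' i a / fact i * (y - a) ^ i)
        = (\<Sum>i\<le>m. G I i a / fact i * (y - a) ^ i) + ?J / fact m * (y - a) ^ m" .
      moreover have "\<bar>f y - (\<Sum>i\<le>m. G I' i a / fact i * (y - a) ^ i)\<bar> \<le> T * h ^ Suc m"
        using False I' int a R y by (intro approx) auto
      ultimately show ?thesis
        using False y by (simp add: diff_diff_eq)
    qed
    then show "\<exists>c. \<forall>y\<in>{b<..<b + h} - {a}. \<bar>f y - (\<Sum>i\<le>m. c i * (y - a) ^ i)
        - ?J / fact m * (indicator {a<..} y * (y - a) ^ m)\<bar> \<le> T * h ^ Suc m"
      by (intro exI[of _ "\<lambda>i. G I i a / fact i"] ballI)
  qed
qed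

text \<open>
  Off \<open>[-1, 1]\<close> the function vanishes on an open set, so all its derivatives have limit \<open>0\<close> there
  from both sides.
\<close>

lemma defect_in_support:
  assumes fs: "\<And>y. y \<notin> {-1..1} \<Longrightarrow> f y = 0" and jump: "deriv_left m f a \<noteq> deriv_right m f a"
  shows "a \<in> {-1..1}"
proof (rule ccontr)
  assume a: "a \<notin> {-1..1}"
  have U: "open (- {-1..1::real})" by (intro open_Compl closed_atLeastAtMost)
  have zero: "\<forall>y\<in>- {-1..1}. (deriv ^^ i) f y = 0" for i
  proof (induction i)
    case (Suc i)
    show ?case
    proof
      fix y :: real assume y: "y \<in> - {-1..1}"
      have "((\<lambda>_. 0) has_real_derivative 0) (at y)" by simp
      then have "((deriv ^^ i) f has_real_derivative 0) (at y)"
        by (rule has_field_derivative_transform_within_open[OF _ U y]) (use Suc in auto)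
      then show "(deriv ^^ Suc i) f y = 0" by (simp add: DERIV_imp_deriv)
    qed
  qed (use fs in auto)
  have "\<forall>\<^sub>F y in at a. 0 = (deriv ^^ m) f y"
    using eventually_at_in_open'[OF U, of a] a zero[of m] by (auto elim: eventually_mono)
  then have "((deriv ^^ m) f \<longlongrightarrow> 0) (at a)"
    by (rule Lim_transform_eventually[OF tendsto_const])
  then have "((deriv ^^ m) f \<longlongrightarrow> 0) (at_left a)" "((deriv ^^ m) f \<longlongrightarrow> 0) (at_right a)"
    by (simp_all add: filterlim_at_split)
  then show False
    using jump unfolding deriv_left_def deriv_right_def by (simp add: tendsto_Lim)
qed

section \<open>Compactly supported wavelets and their integer translates\<close>

lemma integrable_indicator_mult:
  fixes f :: "real \<Rightarrow> real"
  assumes "A \<in> sets borel" "integrable lborel f"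
  shows "integrable lborel (\<lambda>x. indicator A x * f x)"
  using integrable_mult_indicator[of A lborel f] assms by simp

lemma lborel_integral_dilate:
  fixes g :: "real \<Rightarrow> real"
  shows "(LINT x|lborel. g (2 ^ j * x - c)) = (LINT u|lborel. g u) / 2 ^ j"
  using lborel_integral_real_affine[of "2 ^ j" g "- c"] by (simp add: field_simps)

lemma lborel_integrable_dilate:
  fixes g :: "real \<Rightarrow> real"
  assumes "integrable lborel g"
  shows "integrable lborel (\<lambda>x. g (2 ^ j * x - c))"
  using lborel_integrable_real_affine[OF assms, of "2 ^ j" "- c"] by simp

text \<open>
  This is \<open>2\<^bsup>j/2\<^esup>\<close> times the inner product of \<open>f\<close> with \<open>\<psi>\<^sub>j\<^sub>,\<^sub>k\<close>. With this normalisation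
  \<open>Q\<^sub>j f\<close> is the sum of \<open>c\<^sub>k \<psi>(2\<^sup>j x - k)\<close> without any power of two.
\<close>

definition wavelet_coeff :: "(real \<Rightarrow> real) \<Rightarrow> (real \<Rightarrow> real) \<Rightarrow> nat \<Rightarrow> int \<Rightarrow> real" where
  "wavelet_coeff \<psi> f j k = (LINT u|lborel. f ((u + of_int k) / 2 ^ j) * \<psi> u)"

text \<open>
  A wavelet basis reduced to continuity, compact support, vanishing moments and orthonormality of
  \<open>\<psi>\<close>: the operator \<open>Q\<^sub>j\<close> is given by its kernel, which involves the wavelet alone.
\<close>

locale compact_wavelet =
  fixes \<psi> :: "real \<Rightarrow> real" and S d :: nat
  assumes cont: "continuous_on UNIV \<psi>"
    and supp: "\<And>x. x \<notin> {0..real S} \<Longrightarrow> \<psi> x = 0"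
    and moments: "\<And>k. k \<le> d \<Longrightarrow> (LINT x|lborel. x ^ k * \<psi> x) = 0"
    and ortho: "\<And>k l::int. (LINT x|lborel. \<psi> (x - of_int k) * \<psi> (x - of_int l)) = (if k = l then 1 else 0)"
begin

lemma psi_measurable [measurable]: "\<psi> \<in> borel_measurable borel"
  using cont by (rule borel_measurable_continuous_onI)

lemma bdd_above_abs_psi: "bdd_above (range (\<lambda>x. \<bar>\<psi> x\<bar>))"
proof -
  have "compact (\<psi> ` {0..real S})"
    using cont by (intro compact_continuous_image) (auto intro: continuous_on_subset)
  then obtain B where B: "\<And>x. x \<in> {0..real S} \<Longrightarrow> \<bar>\<psi> x\<bar> \<le> B"
    by (meson bounded_real compact_imp_bounded imageI)
  have "\<bar>\<psi> x\<bar> \<le> max B 0" for x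
    using B[of x] supp[of x] by (cases "x \<in> {0..real S}") auto
  then show ?thesis by (intro bdd_aboveI2) auto
qed

lemma abs_psi_le_Psi2: "\<bar>\<psi> x\<bar> \<le> Psi2 \<psi>"
  unfolding Psi2_def using bdd_above_abs_psi by (rule cSUP_upper[OF UNIV_I])

lemma psi_nontrivial: "\<exists>x. \<psi> x \<noteq> 0"
proof (rule ccontr)
  assume "\<nexists>x. \<psi> x \<noteq> 0"
  then show False using ortho[of 0 0] by simp
qed

lemma Psi2_pos: "Psi2 \<psi> > 0"
  using psi_nontrivial abs_psi_le_Psi2 by (metis less_le_trans zero_less_abs_iff)

lemma integrable_times_psi:
  assumes [measurable]: "g \<in> borel_measurable borel" and fin: "finite A"
    and bound: "\<And>u. u \<in> {0<..<real S} - A \<Longrightarrow> \<bar>g u\<bar> \<le> B"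
  shows "integrable lborel (\<lambda>u. g u * \<psi> u)"
proof (rule Bochner_Integration.integrable_bound)
  show "integrable lborel (\<lambda>u. indicator {0..real S} u * (B * Psi2 \<psi>))"
    by simp
  have "A \<union> {0, real S} \<in> null_sets lborel"
    using fin by (intro finite_imp_null_set_lborel) auto
  then have "AE u in lborel. u \<notin> A \<union> {0, real S}"
    by (rule AE_not_in)
  then show "AE u in lborel. norm (g u * \<psi> u) \<le> norm (indicator {0..real S} u * (B * Psi2 \<psi>))"
  proof eventually_elim
    case (elim u)
    show ?case
    proof (cases "u \<in> {0..real S}")
      case True
      then have "u \<in> {0<..<real S} - A" using elim by auto
      then have "\<bar>g u\<bar> * \<bar>\<psi> u\<bar> \<le> B * Psi2 \<psi>"
        using bound[of u] abs_psi_le_Psi2[of u] by (intro mult_mono) auto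
      also have "\<dots> \<le> \<bar>B * Psi2 \<psi>\<bar>" by simp
      finally show ?thesis using True by (simp add: abs_mult)
    qed (simp add: supp)
  qed
qed measurable

lemma integrable_continuous_times_psi:
  assumes "continuous_on UNIV g"
  shows "integrable lborel (\<lambda>u. g u * \<psi> u)"
proof -
  have "compact (g ` {0..real S})"
    using assms by (intro compact_continuous_image) (auto intro: continuous_on_subset)
  then obtain B where "\<And>x. x \<in> {0..real S} \<Longrightarrow> \<bar>g x\<bar> \<le> B"
    by (meson bounded_real compact_imp_bounded imageI)
  then show ?thesis
    using assms by (intro integrable_times_psi[of g "{}" B] borel_measurable_continuous_onI) auto
qed

lemma integrable_psi: "integrable lborel \<psi>"
  using integrable_continuous_times_psi[of "\<lambda>_. 1"] by simp

lemma finite_translates: "finite {k::int. \<psi> (x - of_int k) \<noteq> 0}"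
  and card_translates: "card {k::int. \<psi> (x - of_int k) \<noteq> 0} \<le> S + 1"
proof -
  have sub: "{k::int. \<psi> (x - of_int k) \<noteq> 0} \<subseteq> {\<lceil>x - real S\<rceil>..\<lfloor>x\<rfloor>}"
  proof
    fix k :: int assume "k \<in> {k. \<psi> (x - of_int k) \<noteq> 0}"
    then have "x - of_int k \<in> {0..real S}" using supp by blast
    then show "k \<in> {\<lceil>x - real S\<rceil>..\<lfloor>x\<rfloor>}"
      by (auto simp: le_floor_iff ceiling_le_iff)
  qed
  show "finite {k::int. \<psi> (x - of_int k) \<noteq> 0}"
    using sub by (rule finite_subset) simp
  have "card {k::int. \<psi> (x - of_int k) \<noteq> 0} \<le> card {\<lceil>x - real S\<rceil>..\<lfloor>x\<rfloor>}"
    by (intro card_mono sub) simp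
  also have "\<dots> \<le> S + 1"
    by (simp; linarith)
  finally show "card {k::int. \<psi> (x - of_int k) \<noteq> 0} \<le> S + 1" .
qed

lemma infsum_translates:
  "(\<Sum>\<^sub>\<infinity>k\<in>(UNIV::int set). \<bar>\<psi> (x - of_int k)\<bar>) = (\<Sum>k | \<psi> (x - of_int k) \<noteq> 0. \<bar>\<psi> (x - of_int k)\<bar>)"
proof -
  have "(\<Sum>\<^sub>\<infinity>k\<in>(UNIV::int set). \<bar>\<psi> (x - of_int k)\<bar>)
      = (\<Sum>\<^sub>\<infinity>k\<in>{k::int. \<psi> (x - of_int k) \<noteq> 0}. \<bar>\<psi> (x - of_int k)\<bar>)"
    by (rule infsum_cong_neutral) auto
  then show ?thesis using finite_translates[of x] by simp
qed

text \<open>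
  At most \<open>S + 1\<close> translates are nonzero at a given point, so the supremum defining \<open>\<Psi>\<^sub>0\<close> is
  finite; it then bounds the sum over any finite set of translates.
\<close>

lemma sum_translates_le_Psi0:
  assumes "finite K"
  shows "(\<Sum>k\<in>K. \<bar>\<psi> (x - of_int k)\<bar>) \<le> Psi0 \<psi>"
proof -
  let ?F = "\<lambda>x. {k::int. \<psi> (x - of_int k) \<noteq> 0}"
  have "(\<Sum>k\<in>?F x. \<bar>\<psi> (x - of_int k)\<bar>) \<le> (real S + 1) * Psi2 \<psi>" for x
  proof -
    have "(\<Sum>k\<in>?F x. \<bar>\<psi> (x - of_int k)\<bar>) \<le> real (card (?F x)) * Psi2 \<psi>"
      by (intro sum_bounded_above abs_psi_le_Psi2)
    also have "\<dots> \<le> (real S + 1) * Psi2 \<psi>"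
      using card_translates[of x] Psi2_pos by (intro mult_right_mono) auto
    finally show ?thesis .
  qed
  then have bdd: "bdd_above (range (\<lambda>x. \<Sum>k\<in>?F x. \<bar>\<psi> (x - of_int k)\<bar>))"
    by (intro bdd_aboveI2) auto
  have "(\<Sum>k\<in>K. \<bar>\<psi> (x - of_int k)\<bar>) = (\<Sum>k\<in>K \<inter> ?F x. \<bar>\<psi> (x - of_int k)\<bar>)"
    using assms by (intro sum.mono_neutral_right) auto
  also have "\<dots> \<le> (\<Sum>k\<in>?F x. \<bar>\<psi> (x - of_int k)\<bar>)"
    using finite_translates[of x] by (intro sum_mono2) auto
  also have "\<dots> \<le> Psi0 \<psi>"
    unfolding Psi0_def infsum_translates using bdd by (rule cSUP_upper[OF UNIV_I])
  finally show ?thesis .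
qed

lemma abs_psi_le_Psi0: "\<bar>\<psi> x\<bar> \<le> Psi0 \<psi>"
  using sum_translates_le_Psi0[of "{0}" x] by simp

lemma Psi0_pos: "Psi0 \<psi> > 0"
  using psi_nontrivial abs_psi_le_Psi0 by (metis less_le_trans zero_less_abs_iff)

text \<open>
  Cut the line into unit cells and move every cell to \<open>[0, 1)\<close>: the integral becomes that of a sum of
  translates over an interval of length \<open>1\<close>.
\<close>

lemma L1_norm_le_Psi0: "(LINT x|lborel. \<bar>\<psi> x\<bar>) \<le> Psi0 \<psi>"
proof -
  let ?I = "\<lambda>n::nat. {real n..<real n + 1}"
  have split: "\<bar>\<psi> x\<bar> = (\<Sum>n\<le>S. indicator (?I n) x * \<bar>\<psi> x\<bar>)" for x
  proof (cases "x \<in> {0..real S}")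
    case True
    have "(\<Sum>n\<le>S. indicator (?I n) x * \<bar>\<psi> x\<bar>) = (\<Sum>n\<le>S. if n = nat \<lfloor>x\<rfloor> then \<bar>\<psi> x\<bar> else 0)"
      using True by (intro sum.cong) (auto simp: indicator_def, linarith+)
    also have "nat \<lfloor>x\<rfloor> \<le> S" using True by (simp, linarith)
    then have "(\<Sum>n\<le>S. if n = nat \<lfloor>x\<rfloor> then \<bar>\<psi> x\<bar> else 0) = \<bar>\<psi> x\<bar>" by simp
    finally show ?thesis by simp
  qed (simp add: supp)
  have "(LINT x|lborel. \<bar>\<psi> x\<bar>) = (LINT x|lborel. (\<Sum>n\<le>S. indicator (?I n) x * \<bar>\<psi> x\<bar>))"
    by (rule Bochner_Integration.integral_cong[OF refl split])
  also have "\<dots> = (\<Sum>n\<le>S. LINT x|lborel. indicator (?I n) x * \<bar>\<psi> x\<bar>)"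
    by (intro Bochner_Integration.integral_sum integrable_indicator_mult)
       (auto simp: integrable_psi)
  also have "\<dots> = (\<Sum>n\<le>S. LINT x|lborel. indicator {0..<1} x * \<bar>\<psi> (x - of_int (- int n))\<bar>)"
  proof (intro sum.cong refl)
    fix n
    have "(LINT x|lborel. indicator (?I n) x * \<bar>\<psi> x\<bar>)
        = (LINT x|lborel. indicator (?I n) (real n + 1 * x) * \<bar>\<psi> (real n + 1 * x)\<bar>)"
      by (subst lborel_integral_real_affine[of 1 _ "real n"]) auto
    also have "\<dots> = (LINT x|lborel. indicator {0..<1} x * \<bar>\<psi> (x - of_int (- int n))\<bar>)"
      by (intro Bochner_Integration.integral_cong) (auto simp: indicator_def add.commute)
    finally show "(LINT x|lborel. indicator (?I n) x * \<bar>\<psi> x\<bar>)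
        = (LINT x|lborel. indicator {0..<1} x * \<bar>\<psi> (x - of_int (- int n))\<bar>)" .
  qed
  also have "\<dots> = (LINT x|lborel. (\<Sum>n\<le>S. indicator {0..<1} x * \<bar>\<psi> (x - of_int (- int n))\<bar>))"
  proof (intro Bochner_Integration.integral_sum[symmetric])
    fix n
    have "integrable lborel (\<lambda>x. \<bar>\<psi> (x - of_int (- int n))\<bar>)"
      using lborel_integrable_dilate[OF integrable_abs[OF integrable_psi], of 0 "of_int (- int n)"] by simp
    then show "integrable lborel (\<lambda>x. indicator {0..<1::real} x * \<bar>\<psi> (x - of_int (- int n))\<bar>)"
      by (intro integrable_indicator_mult) auto
  qed
  also have "\<dots> \<le> (LINT x|lborel. indicator {0..<1::real} x * Psi0 \<psi>)"
  proof (rule integral_mono_AE')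
    show "integrable lborel (\<lambda>x. indicator {0..<1::real} x * Psi0 \<psi>)" by simp
    have "(\<Sum>n\<le>S. \<bar>\<psi> (x - of_int (- int n))\<bar>) \<le> Psi0 \<psi>" for x
    proof -
      have "(\<Sum>n\<le>S. \<bar>\<psi> (x - of_int (- int n))\<bar>) = (\<Sum>k\<in>(\<lambda>n. - int n) ` {..S}. \<bar>\<psi> (x - of_int k)\<bar>)"
        by (subst sum.reindex) (auto simp: inj_on_def)
      then show ?thesis by (simp only: sum_translates_le_Psi0 finite_imageI finite_atMost)
    qed
    then show "AE x in lborel. (\<Sum>n\<le>S. indicator {0..<1} x * \<bar>\<psi> (x - of_int (- int n))\<bar>)
        \<le> indicator {0..<1::real} x * Psi0 \<psi>"
      by (simp add: sum_distrib_left[symmetric] mult_left_mono)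
    show "AE x in lborel. 0 \<le> indicator {0..<1::real} x * Psi0 \<psi>"
      using Psi0_pos by (intro AE_I2) auto
  qed
  also have "\<dots> = Psi0 \<psi>" by simp
  finally show ?thesis .
qed

text \<open>
  If \<open>S = 0\<close>, the wavelet would vanish almost everywhere and could not have norm \<open>1\<close>.
\<close>

lemma S_pos: "S > 0"
proof (rule ccontr)
  assume "\<not> S > 0"
  then have "\<psi> x * \<psi> x = indicator {0} x * (\<psi> 0 * \<psi> 0)" for x
    using supp[of x] by (auto simp: indicator_def)
  then have "(LINT x|lborel. \<psi> x * \<psi> x) = (LINT x|lborel. indicator {0::real} x * (\<psi> 0 * \<psi> 0))"
    by (intro Bochner_Integration.integral_cong refl)
  then show False using ortho[of 0 0] by simp
qed

section \<open>Vanishing moments and truncated powers\<close>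

lemma moments_affine:
  assumes "i \<le> d"
  shows "(LINT u|lborel. (\<alpha> * u + \<beta>) ^ i * \<psi> u) = 0"
proof -
  have "(\<alpha> * u + \<beta>) ^ i * \<psi> u = (\<Sum>k\<le>i. (real (i choose k) * \<alpha> ^ k * \<beta> ^ (i - k)) * (u ^ k * \<psi> u))" for u
    by (simp add: binomial_ring sum_distrib_right sum_distrib_left power_mult_distrib mult_ac)
  then have "(LINT u|lborel. (\<alpha> * u + \<beta>) ^ i * \<psi> u)
      = (LINT u|lborel. (\<Sum>k\<le>i. (real (i choose k) * \<alpha> ^ k * \<beta> ^ (i - k)) * (u ^ k * \<psi> u)))"
    by simp
  also have "\<dots> = (\<Sum>k\<le>i. (LINT u|lborel. (real (i choose k) * \<alpha> ^ k * \<beta> ^ (i - k)) * (u ^ k * \<psi> u)))"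
    by (intro Bochner_Integration.integral_sum integrable_mult_right integrable_continuous_times_psi
        continuous_intros)
  also have "\<dots> = 0"
    using assms by (intro sum.neutral) (auto simp: moments)
  finally show ?thesis .
qed

text \<open>
  The coefficient of the truncated power \<open>(u - s)\<^sub>+\<^sup>m\<close>. Spelling the truncation as an indicator
  gives the Heaviside function, with value \<open>0\<close> at \<open>s\<close>, when \<open>m = 0\<close>.
\<close>

definition jump_moment :: "nat \<Rightarrow> real \<Rightarrow> real" where
  "jump_moment m s = (LINT u|lborel. (indicator {s<..} u * (u - s) ^ m) * \<psi> u)"

lemma integrable_jump_psi: "integrable lborel (\<lambda>u. (indicator {s<..} u * (u - s) ^ m) * \<psi> u)"
proof -
  have "integrable lborel (\<lambda>u. indicator {s<..} u * ((u - s) ^ m * \<psi> u))"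
    by (intro integrable_indicator_mult integrable_continuous_times_psi
        continuous_intros) auto
  then show ?thesis by (simp add: mult.assoc)
qed

lemma abs_jump_moment_le:
  assumes "0 \<le> s" "s \<le> real S"
  shows "\<bar>jump_moment m s\<bar> \<le> Psi2 \<psi> * real S ^ (m + 1) / real (m + 1)"
proof -
  have FTC: "has_bochner_integral lborel (\<lambda>u. (u - s) ^ m * indicator {s..real S} u) ((real S - s) ^ Suc m / real (Suc m) - (s - s) ^ Suc m / real (Suc m))"
    by (rule has_bochner_integral_FTC_Icc_real)
       (use assms in \<open>auto intro!: derivative_eq_intros continuous_intros simp del: power_Suc of_nat_Suc\<close>)
  have pw: "\<bar>(indicator {s<..} u * (u - s) ^ m) * \<psi> u\<bar> \<le> Psi2 \<psi> * ((u - s) ^ m * indicator {s..real S} u)" for u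
  proof (cases "u \<in> {s<..real S}")
    case True
    then show ?thesis
      using abs_psi_le_Psi2[of u] by (auto simp: abs_mult power_abs indicator_def mult.commute mult_left_mono)
  next
    case False
    then have "(indicator {s<..} u * (u - s) ^ m) * \<psi> u = 0"
      using supp[of u] by (auto simp: indicator_def)
    then show ?thesis
      using Psi2_pos by (auto simp: indicator_def)
  qed
  have "\<bar>jump_moment m s\<bar> \<le> (LINT u|lborel. \<bar>(indicator {s<..} u * (u - s) ^ m) * \<psi> u\<bar>)"
    unfolding jump_moment_def by (rule integral_abs_bound)
  also have "\<dots> \<le> (LINT u|lborel. Psi2 \<psi> * ((u - s) ^ m * indicator {s..real S} u))"
    by (intro integral_mono pw integrable_abs integrable_jump_psi integrable_mult_right
        integrable.intros[OF FTC])
  also have "\<dots> = Psi2 \<psi> * ((real S - s) ^ (m + 1) / real (m + 1))"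
    using has_bochner_integral_integral_eq[OF FTC] by simp
  also have "\<dots> \<le> Psi2 \<psi> * (real S ^ (m + 1) / real (m + 1))"
    using assms Psi2_pos by (intro mult_left_mono divide_right_mono power_mono) auto
  finally show ?thesis by simp
qed

text \<open>
  The full power \<open>(u - s)\<^sup>m\<close> has integral \<open>0\<close> against \<open>\<psi>\<close>, so the parts to the right and to the
  left of \<open>s\<close> cancel.
\<close>

lemma abs_jump_moment_eq:
  assumes "m \<le> d" "0 \<le> s"
  shows "\<bar>jump_moment m s\<bar> = \<bar>LINT u:{0..s}|lborel. (s - u) ^ m * \<psi> u\<bar>"
proof -
  have split: "(u - s) ^ m * \<psi> u = (indicator {s<..} u * (u - s) ^ m) * \<psi> u
      + (-1) ^ m * (indicator {0..s} u * ((s - u) ^ m * \<psi> u))" for u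
  proof -
    have "(u - s) ^ m = (-1) ^ m * (s - u) ^ m"
      by (simp flip: power_mult_distrib)
    then show ?thesis using supp[of u] by (auto simp: indicator_def)
  qed
  have int: "integrable lborel (\<lambda>u. indicator {0..s} u * ((s - u) ^ m * \<psi> u))"
    by (intro integrable_indicator_mult integrable_continuous_times_psi
        continuous_intros) auto
  have "0 = (LINT u|lborel. (1 * u + (- s)) ^ m * \<psi> u)"
    using moments_affine[OF assms(1), of 1 "- s"] by simp
  also have "\<dots> = (LINT u|lborel. (indicator {s<..} u * (u - s) ^ m) * \<psi> u
      + (-1) ^ m * (indicator {0..s} u * ((s - u) ^ m * \<psi> u)))"
    using split by (intro Bochner_Integration.integral_cong) auto
  also have "\<dots> = jump_moment m s + (-1) ^ m * (LINT u:{0..s}|lborel. (s - u) ^ m * \<psi> u)"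
    unfolding jump_moment_def set_lebesgue_integral_def real_scaleR_def
    using int integrable_jump_psi by (subst Bochner_Integration.integral_add) auto
  finally have "jump_moment m s = - ((-1) ^ m * (LINT u:{0..s}|lborel. (s - u) ^ m * \<psi> u))"
    by simp
  then show ?thesis by (simp add: abs_mult power_abs)
qed

text \<open>
  A nowhere vanishing continuous function has constant sign on \<open>(0, t]\<close>. Up to this sign the integral
  over \<open>[0, s]\<close> is one of a nonnegative integrand that grows with \<open>s\<close>, so it is smallest at
  \<open>s = \<delta>\<close>, where \<open>\<Psi>\<^sub>1\<close> bounds it from below.
\<close>

lemma Psi1_le_jump_moment:
  assumes m: "m \<le> d" and \<delta>: "0 < \<delta>" and s: "\<delta> \<le> s" "s \<le> t"
    and nonzero: "\<And>x. x \<in> {0<..t} \<Longrightarrow> \<psi> x \<noteq> 0"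
  shows "Psi1 \<psi> d \<delta> \<le> \<bar>jump_moment m s\<bar>"
proof -
  \<comment> \<open>\<open>\<sigma>\<close> is the sign of \<open>\<psi>\<close> on \<open>(0, t]\<close>\<close>
  obtain \<sigma> where \<sigma>: "\<bar>\<sigma>\<bar> = (1::real)" "\<And>x. x \<in> {0<..t} \<Longrightarrow> \<bar>\<psi> x\<bar> = \<sigma> * \<psi> x"
  proof -
    have "\<psi> x > 0" if "x \<in> {0<..t}" "y \<in> {0<..t}" "\<psi> y > 0" for x y
    proof (rule ccontr)
      assume "\<not> \<psi> x > 0"
      then have "0 \<in> closed_segment (\<psi> x) (\<psi> y)"
        using that(3) by (simp add: closed_segment_eq_real_ivl)
      then obtain z where "z \<in> closed_segment x y" "\<psi> z = 0"
        using IVT'_closed_segment_real[of 0 \<psi> x y] cont continuous_on_subset by blast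
      then show False
        using nonzero[of z] that(1,2) by (auto simp: closed_segment_eq_real_ivl split: if_splits)
    qed
    then consider "\<forall>x\<in>{0<..t}. \<psi> x > 0" | "\<forall>x\<in>{0<..t}. \<psi> x < 0"
      using nonzero by (metis linorder_neqE)
    then show ?thesis
      by cases (use that[of 1] that[of "-1"] in force)+
  qed
  have eq: "\<bar>LINT u:{0..v}|lborel. (v - u) ^ m * \<psi> u\<bar> = (LINT u:{0..v}|lborel. (v - u) ^ m * \<bar>\<psi> u\<bar>)"
    if v: "0 < v" "v \<le> t" for v
  proof -
    have nn: "0 \<le> (LINT u:{0..v}|lborel. (v - u) ^ m * \<bar>\<psi> u\<bar>)"
      unfolding set_lebesgue_integral_def
      by (intro integral_nonneg_AE AE_I2) (auto simp: indicator_def)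
    have "AE u in lborel. u \<notin> {0::real}"
      by (intro AE_not_in finite_imp_null_set_lborel) auto
    then have "AE u in lborel. u \<in> {0..v} \<longrightarrow> (v - u) ^ m * \<bar>\<psi> u\<bar> = \<sigma> * ((v - u) ^ m * \<psi> u)"
      by eventually_elim (use \<sigma>(2) v in auto)
    then have "(LINT u:{0..v}|lborel. (v - u) ^ m * \<bar>\<psi> u\<bar>) = (LINT u:{0..v}|lborel. \<sigma> * ((v - u) ^ m * \<psi> u))"
      by (intro set_lebesgue_integral_cong_AE) auto
    also have "\<dots> = \<sigma> * (LINT u:{0..v}|lborel. (v - u) ^ m * \<psi> u)"
      by (rule set_integral_mult_right)
    finally show ?thesis using nn \<sigma>(1) by (metis abs_mult abs_of_nonneg mult_1)
  qed
  have int: "set_integrable lborel {0..v} (\<lambda>u. (v - u) ^ m * \<bar>\<psi> u\<bar>)" for v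
  proof -
    have "integrable lborel (\<lambda>u. \<bar>(v - u) ^ m * \<psi> u\<bar> * indicator {0..v} u)"
      by (intro integrable_real_mult_indicator integrable_abs integrable_continuous_times_psi continuous_intros) auto
    moreover have "\<bar>(v - u) ^ m * \<psi> u\<bar> * indicator {0..v} u = indicator {0..v} u *\<^sub>R ((v - u) ^ m * \<bar>\<psi> u\<bar>)" for u
      by (auto simp: indicator_def abs_mult power_abs)
    ultimately show ?thesis by (simp add: set_integrable_def)
  qed
  have "Psi1 \<psi> d \<delta> \<le> \<bar>LINT u:{0..\<delta>}|lborel. (\<delta> - u) ^ m * \<psi> u\<bar>"
    unfolding Psi1_def using m by (intro Min_le) auto
  also have "\<dots> = (LINT u:{0..\<delta>}|lborel. (\<delta> - u) ^ m * \<bar>\<psi> u\<bar>)"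
    using \<delta> s by (intro eq) auto
  also have "\<dots> \<le> (LINT u:{0..s}|lborel. (s - u) ^ m * \<bar>\<psi> u\<bar>)"
    using int[of \<delta>] int[of s] s \<delta> unfolding set_integrable_def set_lebesgue_integral_def
    by (intro integral_mono) (auto simp: indicator_def intro!: mult_right_mono power_mono)
  also have "\<dots> = \<bar>jump_moment m s\<bar>"
    using eq[of s] \<delta> s abs_jump_moment_eq[OF m, of s] by simp
  finally show ?thesis .
qed

text \<open>
  The polynomial part of \<open>f\<close> integrates to \<open>0\<close>, so only the truncated power and the remainder are
  left. The finite exceptional set takes care of a defect point, where the value of \<open>f\<close> is arbitrary
  if \<open>m = 0\<close>.
\<close>

lemma wavelet_coeff_approx:
  assumes f [measurable]: "f \<in> borel_measurable borel" and m: "m \<le> d" and A: "finite A"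
    and close: "\<And>u. u \<in> {0<..<real S} - A \<Longrightarrow>
      \<bar>f ((u + of_int k) / 2 ^ j) - (\<Sum>i\<le>m. c i * ((u + of_int k) / 2 ^ j - y) ^ i)
        - b * (indicator {s<..} u * (u - s) ^ m)\<bar> \<le> \<epsilon>"
  shows "\<bar>wavelet_coeff \<psi> f j k - b * jump_moment m s\<bar> \<le> \<epsilon> * (LINT u|lborel. \<bar>\<psi> u\<bar>)"
proof -
  define x where "x u = (u + of_int k) / (2::real) ^ j" for u
  have [measurable]: "x \<in> borel_measurable borel" unfolding x_def by measurable
  define R where "R u = f (x u) - (\<Sum>i\<le>m. c i * (x u - y) ^ i) - b * (indicator {s<..} u * (u - s) ^ m)" for u
  have [measurable]: "R \<in> borel_measurable borel" unfolding R_def by measurable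
  have poly_cont: "continuous_on UNIV (\<lambda>u. \<Sum>i\<le>m. c i * (x u - y) ^ i)"
    unfolding x_def by (intro continuous_intros) auto
  have iR: "integrable lborel (\<lambda>u. R u * \<psi> u)"
    by (rule integrable_times_psi[OF _ A, of _ \<epsilon>]) (use close in \<open>auto simp: R_def x_def\<close>)
  have iP: "integrable lborel (\<lambda>u. (\<Sum>i\<le>m. c i * (x u - y) ^ i) * \<psi> u)"
    by (rule integrable_continuous_times_psi[OF poly_cont])
  have "(LINT u|lborel. (\<Sum>i\<le>m. c i * (x u - y) ^ i) * \<psi> u)
      = (LINT u|lborel. (\<Sum>i\<le>m. c i * ((1 / 2 ^ j * u + (of_int k / 2 ^ j - y)) ^ i * \<psi> u)))"
    by (intro Bochner_Integration.integral_cong refl)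
       (auto simp: x_def sum_distrib_right mult.assoc add_divide_distrib add_diff_eq)
  also have "\<dots> = (\<Sum>i\<le>m. (LINT u|lborel. c i * ((1 / 2 ^ j * u + (of_int k / 2 ^ j - y)) ^ i * \<psi> u)))"
    by (intro Bochner_Integration.integral_sum integrable_mult_right integrable_continuous_times_psi continuous_intros)
  also have "\<dots> = 0"
    using m by (intro sum.neutral) (auto simp: moments_affine simp del: times_divide_eq_left)
  finally have P0: "(LINT u|lborel. (\<Sum>i\<le>m. c i * (x u - y) ^ i) * \<psi> u) = 0" .
  have "wavelet_coeff \<psi> f j k = (LINT u|lborel. R u * \<psi> u
      + ((\<Sum>i\<le>m. c i * (x u - y) ^ i) * \<psi> u + b * ((indicator {s<..} u * (u - s) ^ m) * \<psi> u)))"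
    unfolding wavelet_coeff_def R_def x_def
    by (intro Bochner_Integration.integral_cong refl) (simp add: algebra_simps)
  also have "\<dots> = (LINT u|lborel. R u * \<psi> u) + b * jump_moment m s"
    using iR iP integrable_jump_psi[of s m] P0
    by (simp add: jump_moment_def)
  finally have "\<bar>wavelet_coeff \<psi> f j k - b * jump_moment m s\<bar> = \<bar>LINT u|lborel. R u * \<psi> u\<bar>"
    by simp
  also have "\<dots> \<le> (LINT u|lborel. \<bar>R u * \<psi> u\<bar>)" by (rule integral_abs_bound)
  also have "\<dots> \<le> (LINT u|lborel. \<epsilon> * \<bar>\<psi> u\<bar>)"
  proof (rule integral_mono_AE)
    have "A \<union> {0, real S} \<in> null_sets lborel"
      using A by (intro finite_imp_null_set_lborel) auto
    then have "AE u in lborel. u \<notin> A \<union> {0, real S}"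
      by (rule AE_not_in)
    then show "AE u in lborel. \<bar>R u * \<psi> u\<bar> \<le> \<epsilon> * \<bar>\<psi> u\<bar>"
    proof eventually_elim
      case (elim u)
      show ?case
      proof (cases "u \<in> {0..real S}")
        case True
        then have "\<bar>R u\<bar> \<le> \<epsilon>"
          using close[of u] elim by (auto simp: R_def x_def)
        then show ?thesis by (simp add: abs_mult mult_right_mono)
      qed (simp add: supp)
    qed
  qed (use iR integrable_psi in auto)
  also have "\<dots> = \<epsilon> * (LINT u|lborel. \<bar>\<psi> u\<bar>)" by simp
  finally show ?thesis .
qed

section \<open>The detail operator as a finite wavelet sum\<close>

text \<open>
  All indices for which the interval \<open>[k / 2\<^sup>j, (k + S) / 2\<^sup>j]\<close> meets \<open>[-1, 1]\<close>.
\<close>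

definition active_indices :: "nat \<Rightarrow> int set" where
  "active_indices j = {- (2 ^ j) - int S..2 ^ j}"

lemma wavelet_coeff_eq_0:
  assumes f: "\<And>y. y \<notin> {-1..1} \<Longrightarrow> f y = 0" and k: "k \<notin> active_indices j"
  shows "wavelet_coeff \<psi> f j k = 0"
proof -
  have zero: "f ((u + of_int k) / 2 ^ j) * \<psi> u = 0" for u
  proof (cases "u \<in> {0..real S}")
    case True
    from k have "k > 2 ^ j \<or> k < - (2 ^ j) - int S" by (auto simp: active_indices_def)
    then have "real_of_int k > real_of_int (2 ^ j) \<or> real_of_int k < real_of_int (- (2 ^ j) - int S)"
      by (simp only: of_int_less_iff)
    then have "of_int k > (2::real) ^ j \<or> of_int k < - ((2::real) ^ j) - real S"
      by simp
    then have "u + of_int k > (2::real) ^ j \<or> u + of_int k < - ((2::real) ^ j)"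
      using True unfolding atLeastAtMost_iff by linarith
    then have "(u + of_int k) / 2 ^ j \<notin> {-1..1}"
      by (auto simp: field_simps)
    then show ?thesis using f by simp
  qed (simp add: supp)
  show ?thesis unfolding wavelet_coeff_def zero by simp
qed

text \<open>
  For fixed \<open>x\<close> only finitely many terms of the kernel are nonzero, so the sum can be exchanged with
  the integral.
\<close>

lemma detail_operator_eq_sum:
  assumes fm [measurable]: "f \<in> borel_measurable borel" and A: "finite A"
    and bound: "\<And>y. y \<notin> A \<Longrightarrow> \<bar>f y\<bar> \<le> B" and fs: "\<And>y. y \<notin> {-1..1} \<Longrightarrow> f y = 0"
  shows "detail_operator \<psi> j f x = (\<Sum>k\<in>active_indices j. wavelet_coeff \<psi> f j k * \<psi> (2 ^ j * x - of_int k))"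
proof -
  \<comment> \<open>all indices at which either the wavelet at \<open>x\<close> or the coefficient of \<open>f\<close> may be nonzero\<close>
  define M where "M = active_indices j \<union> {k. \<psi> (2 ^ j * x - of_int k) \<noteq> 0}"
  have finM: "finite M" "active_indices j \<subseteq> M"
    unfolding M_def using finite_translates by (auto simp: active_indices_def)
  have int: "integrable lborel (\<lambda>y. \<psi> (2 ^ j * y - of_int k) * f y)" for k :: int
  proof -
    have "integrable lborel (\<lambda>u. f ((u + of_int k) / 2 ^ j) * \<psi> u)"
    proof (rule integrable_times_psi[where A = "(\<lambda>a. 2 ^ j * a - of_int k) ` A" and B = B])
      fix u assume u: "u \<in> {0<..<real S} - (\<lambda>a. 2 ^ j * a - of_int k) ` A"
      have "u = 2 ^ j * ((u + of_int k) / 2 ^ j) - of_int k" by simp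
      then have "(u + of_int k) / 2 ^ j \<notin> A" using u by (metis DiffD2 imageI)
      then show "\<bar>f ((u + of_int k) / 2 ^ j)\<bar> \<le> B" by (rule bound)
    qed (use A in auto)
    from lborel_integrable_dilate[OF this, of j "of_int k"] show ?thesis
      by (simp add: mult.commute)
  qed
  have coeff: "(LINT y|lborel. \<psi> (2 ^ j * y - of_int k) * f y) = wavelet_coeff \<psi> f j k / 2 ^ j" for k
    using lborel_integral_dilate[of "\<lambda>u. f ((u + of_int k) / 2 ^ j) * \<psi> u" j "of_int k"]
    by (simp add: wavelet_coeff_def mult.commute)
  have pw: "2 powr (real j / 2) * 2 powr (real j / 2) = (2::real) ^ j"
    by (simp flip: powr_add add: powr_realpow)
  have kernel: "wavelet_kernel \<psi> j x y = (\<Sum>k\<in>M. 2 ^ j * \<psi> (2 ^ j * x - of_int k) * \<psi> (2 ^ j * y - of_int k))" for y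
  proof -
    have "wavelet_kernel \<psi> j x y = (\<Sum>\<^sub>\<infinity>k\<in>M. wavelet \<psi> j k x * wavelet \<psi> j k y)"
      unfolding wavelet_kernel_def by (rule infsum_cong_neutral) (auto simp: M_def wavelet_def)
    also have "\<dots> = (\<Sum>k\<in>M. wavelet \<psi> j k x * wavelet \<psi> j k y)"
      using finM by simp
    also have "\<dots> = (\<Sum>k\<in>M. 2 ^ j * \<psi> (2 ^ j * x - of_int k) * \<psi> (2 ^ j * y - of_int k))"
      by (intro sum.cong refl) (simp add: wavelet_def flip: pw)
    finally show ?thesis .
  qed
  have "detail_operator \<psi> j f x
      = (LINT y|lborel. (\<Sum>k\<in>M. (2 ^ j * \<psi> (2 ^ j * x - of_int k)) * (\<psi> (2 ^ j * y - of_int k) * f y)))"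
    unfolding detail_operator_def kernel by (simp add: sum_distrib_right mult.assoc)
  also have "\<dots> = (\<Sum>k\<in>M. LINT y|lborel. (2 ^ j * \<psi> (2 ^ j * x - of_int k)) * (\<psi> (2 ^ j * y - of_int k) * f y))"
    by (intro Bochner_Integration.integral_sum integrable_mult_right int)
  also have "\<dots> = (\<Sum>k\<in>M. wavelet_coeff \<psi> f j k * \<psi> (2 ^ j * x - of_int k))"
    by (intro sum.cong refl) (simp add: coeff)
  also have "\<dots> = (\<Sum>k\<in>active_indices j. wavelet_coeff \<psi> f j k * \<psi> (2 ^ j * x - of_int k))"
    using finM wavelet_coeff_eq_0[OF fs] by (intro sum.mono_neutral_right) auto
  finally show ?thesis .
qed

section \<open>Size of the wavelet coefficients\<close>

text \<open>
  The interval is open because a defect point at one of its ends does no harm: without further defect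
  points inside, \<open>f\<close> is smooth up to the boundary of the interval, and the coefficient is small.
\<close>

definition wavelet_support :: "nat \<Rightarrow> int \<Rightarrow> real set" where
  "wavelet_support j k = {of_int k / 2 ^ j<..<of_int k / 2 ^ j + real S / 2 ^ j}"

lemma in_wavelet_support_iff:
  "a \<in> wavelet_support j k \<longleftrightarrow> 0 < 2 ^ j * a - of_int k \<and> 2 ^ j * a - of_int k < real S"
proof -
  have "of_int k / 2 ^ j < a \<longleftrightarrow> of_int k < 2 ^ j * a"
    by (simp add: divide_less_eq mult.commute)
  moreover have "a < of_int k / 2 ^ j + real S / 2 ^ j \<longleftrightarrow> 2 ^ j * a < of_int k + real S"
    by (simp add: less_divide_eq mult.commute flip: add_divide_distrib)
  ultimately show ?thesis unfolding wavelet_support_def by auto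
qed

text \<open>
  The level \<open>N\<close> is chosen such that from there on the supports of the wavelets are shorter than the
  smallest distance between two defect points.
\<close>

lemma wavelet_coeff_estimates:
  assumes ps: "piecewise_smooth f m as" and m: "m \<le> d"
  obtains C N where "C > 0"
    and "\<forall>j\<ge>N. \<forall>k\<in>active_indices j. wavelet_support j k \<inter> set as = {} \<longrightarrow>
      \<bar>wavelet_coeff \<psi> f j k\<bar> \<le> C / 2 ^ (j * Suc m)"
    and "\<forall>j\<ge>N. \<forall>k\<in>active_indices j. \<forall>a\<in>wavelet_support j k \<inter> set as.
      \<bar>wavelet_coeff \<psi> f j k - (deriv_right m f a - deriv_left m f a) / fact m / 2 ^ (j * m)
         * jump_moment m (2 ^ j * a - of_int k)\<bar> \<le> C / 2 ^ (j * Suc m)"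
proof -
  \<comment> \<open>for every level \<open>j\<close>, the intervals of the active indices lie in \<open>[-R, R]\<close>\<close>
  define R where "R = 1 + real S"
  note fm = piecewise_smooth_measurable[OF ps]
  obtain C where C: "C > 0"
    and expansions: "\<forall>b h. h > 0 \<and> -R \<le> b \<and> b + h \<le> R \<and> {b<..<b + h} \<inter> set as = {} \<longrightarrow>
      (\<exists>c. \<forall>y\<in>{b<..<b + h}. \<bar>f y - (\<Sum>i\<le>m. c i * (y - b) ^ i)\<bar> \<le> C * h ^ Suc m)"
      "\<forall>b h a. h > 0 \<and> -R \<le> b \<and> b + h \<le> R \<and> {b<..<b + h} \<inter> set as = {a} \<longrightarrow>
      (\<exists>c. \<forall>y\<in>{b<..<b + h} - {a}. \<bar>f y - (\<Sum>i\<le>m. c i * (y - a) ^ i)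
        - (deriv_right m f a - deriv_left m f a) / fact m * (indicator {a<..} y * (y - a) ^ m)\<bar> \<le> C * h ^ Suc m)"
    by (rule piecewise_smooth_local_expansion[OF ps, where R = R])
  note regular = expansions(1)[rule_format, OF conjI[OF _ conjI[OF _ conjI]]]
    and singular = expansions(2)[rule_format, OF conjI[OF _ conjI[OF _ conjI]]]
  obtain \<rho> where \<rho>: "\<rho> > 0" "\<And>a b. a \<in> set as \<Longrightarrow> b \<in> set as \<Longrightarrow> a \<noteq> b \<Longrightarrow> \<rho> \<le> \<bar>a - b\<bar>"
    using finite_real_separation[of "set as"] by auto
  obtain N where N: "real S / \<rho> < 2 ^ N"
    using real_arch_pow[of 2 "real S / \<rho>"] by auto
  define C' where "C' = C * real S ^ Suc m * Psi0 \<psi>"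
  have C': "C * (real S / 2 ^ j) ^ Suc m * (LINT u|lborel. \<bar>\<psi> u\<bar>) \<le> C' / 2 ^ (j * Suc m)" for j
  proof -
    have "C * (real S / 2 ^ j) ^ Suc m * (LINT u|lborel. \<bar>\<psi> u\<bar>) \<le> C * (real S / 2 ^ j) ^ Suc m * Psi0 \<psi>"
      using C L1_norm_le_Psi0 by (intro mult_left_mono) auto
    also have "\<dots> = C' / 2 ^ (j * Suc m)"
      unfolding C'_def by (simp only: power_divide power_mult) simp
    finally show ?thesis .
  qed
  have h: "real S / 2 ^ j > 0" "real S / 2 ^ j \<le> real S" for j
    using S_pos by (auto simp: field_simps)
  have active: "-R \<le> of_int k / 2 ^ j" "of_int k / 2 ^ j + real S / 2 ^ j \<le> R" if "k \<in> active_indices j" for j k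
  proof -
    have "- (2 ^ j) - int S \<le> k" "k \<le> 2 ^ j" using that by (auto simp: active_indices_def)
    then have "real_of_int (- (2 ^ j) - int S) \<le> of_int k" "of_int k \<le> real_of_int (2 ^ j)"
      by (simp_all only: of_int_le_iff)
    then have "- (2 ^ j) - real S \<le> real_of_int k" "real_of_int k \<le> 2 ^ j" by simp_all
    then have "(- (2 ^ j) - real S) / 2 ^ j \<le> of_int k / 2 ^ j" "of_int k / 2 ^ j \<le> 2 ^ j / (2::real) ^ j"
      by (intro divide_right_mono; simp)+
    then have "- 1 - real S / 2 ^ j \<le> of_int k / 2 ^ j" "of_int k / 2 ^ j \<le> (1::real)"
      by (simp_all add: diff_divide_distrib)
    then show "-R \<le> of_int k / 2 ^ j" "of_int k / 2 ^ j + real S / 2 ^ j \<le> R"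
      using h(2)[of j] unfolding R_def by linarith+
  qed
  have dilated: "(u + of_int k) / 2 ^ j \<in> wavelet_support j k" if "u \<in> {0<..<real S}" for u j k
    using that unfolding wavelet_support_def by (auto simp: add_divide_distrib divide_strict_right_mono)
  show ?thesis
  proof (rule that; (intro allI impI ballI)?)
    show "C' > 0" unfolding C'_def using C Psi0_pos S_pos by simp
  next
    fix j k assume j: "N \<le> j" and k: "k \<in> active_indices j" and free: "wavelet_support j k \<inter> set as = {}"
    obtain c where c: "\<forall>y\<in>wavelet_support j k.
        \<bar>f y - (\<Sum>i\<le>m. c i * (y - of_int k / 2 ^ j) ^ i)\<bar> \<le> C * (real S / 2 ^ j) ^ Suc m"
      using regular[OF h(1) active[OF k] free[unfolded wavelet_support_def]]
      unfolding wavelet_support_def by blast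
    have "\<bar>wavelet_coeff \<psi> f j k - 0 * jump_moment m 0\<bar>
        \<le> C * (real S / 2 ^ j) ^ Suc m * (LINT u|lborel. \<bar>\<psi> u\<bar>)"
    proof (rule wavelet_coeff_approx[OF fm m, of "{}"])
      fix u assume "u \<in> {0<..<real S} - {}"
      then have "(u + of_int k) / 2 ^ j \<in> wavelet_support j k" by (intro dilated) auto
      then show "\<bar>f ((u + of_int k) / 2 ^ j) - (\<Sum>i\<le>m. c i * ((u + of_int k) / 2 ^ j - of_int k / 2 ^ j) ^ i)
          - 0 * (indicator {0<..} u * (u - 0) ^ m)\<bar> \<le> C * (real S / 2 ^ j) ^ Suc m"
        using c by (simp only: mult_zero_left diff_zero)
    qed auto
    then show "\<bar>wavelet_coeff \<psi> f j k\<bar> \<le> C' / 2 ^ (j * Suc m)"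
      using C'[of j] by linarith
  next
    fix j k a assume j: "N \<le> j" and k: "k \<in> active_indices j" and a: "a \<in> wavelet_support j k \<inter> set as"
    have "(2::real) ^ N \<le> 2 ^ j" using j by simp
    then have small: "real S / 2 ^ j < \<rho>"
    proof -
      have "real S / \<rho> < 2 ^ j" using N \<open>2 ^ N \<le> 2 ^ j\<close> by linarith
      then show ?thesis using \<rho>(1) by (simp add: field_simps)
    qed
    have "a' = a" if "a' \<in> wavelet_support j k \<inter> set as" for a'
    proof (rule ccontr)
      assume "a' \<noteq> a"
      then have "\<rho> \<le> \<bar>a' - a\<bar>" using \<rho>(2)[of a' a] a that by blast
      moreover have "\<bar>a' - a\<bar> < real S / 2 ^ j"
        using a that unfolding wavelet_support_def by (auto simp: abs_if)
      ultimately show False using small by linarith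
    qed
    then have single: "wavelet_support j k \<inter> set as = {a}" using a by blast
    define J where "J = (deriv_right m f a - deriv_left m f a) / fact m"
    define s where "s = 2 ^ j * a - of_int k"
    obtain c where c: "\<forall>y\<in>wavelet_support j k - {a}. \<bar>f y - (\<Sum>i\<le>m. c i * (y - a) ^ i)
        - J * (indicator {a<..} y * (y - a) ^ m)\<bar> \<le> C * (real S / 2 ^ j) ^ Suc m"
      using singular[OF h(1) active[OF k] single[unfolded wavelet_support_def]]
      unfolding wavelet_support_def J_def by blast
    have "\<bar>wavelet_coeff \<psi> f j k - J / 2 ^ (j * m) * jump_moment m s\<bar>
        \<le> C * (real S / 2 ^ j) ^ Suc m * (LINT u|lborel. \<bar>\<psi> u\<bar>)"
    proof (rule wavelet_coeff_approx[OF fm m, of "{s}"])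
      fix u assume u: "u \<in> {0<..<real S} - {s}"
      define y where "y = (u + of_int k) / 2 ^ j"
      have ya: "y - a = (u - s) / 2 ^ j" by (simp add: y_def s_def field_simps)
      have "y \<in> wavelet_support j k - {a}"
        using dilated[of u k j] u ya by (auto simp: y_def)
      moreover have "indicator {a<..} y = (indicator {s<..} u :: real)"
      proof -
        have "a < y \<longleftrightarrow> 0 < (u - s) / 2 ^ j" using ya by linarith
        then show ?thesis by (auto simp: indicator_def zero_less_divide_iff)
      qed
      then have "J * (indicator {a<..} y * (y - a) ^ m)
          = J / 2 ^ (j * m) * (indicator {s<..} u * (u - s) ^ m)"
        by (simp add: ya power_divide power_mult)
      ultimately show "\<bar>f ((u + of_int k) / 2 ^ j) - (\<Sum>i\<le>m. c i * ((u + of_int k) / 2 ^ j - a) ^ i)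
          - J / 2 ^ (j * m) * (indicator {s<..} u * (u - s) ^ m)\<bar> \<le> C * (real S / 2 ^ j) ^ Suc m"
        using c unfolding y_def by metis
    qed auto
    then show "\<bar>wavelet_coeff \<psi> f j k - (deriv_right m f a - deriv_left m f a) / fact m / 2 ^ (j * m)
         * jump_moment m (2 ^ j * a - of_int k)\<bar> \<le> C' / 2 ^ (j * Suc m)"
      using C'[of j] unfolding J_def s_def by linarith
  qed
qed

text \<open>
  An index whose interval contains \<open>a\<close> satisfies \<open>2\<^sup>j a - S < k < 2\<^sup>j a\<close>, which leaves at most \<open>S\<close>
  integers.
\<close>

lemma card_singular_indices:
  fixes A :: "real set" and j :: nat
  assumes "finite A"
  defines "K \<equiv> {k. wavelet_support j k \<inter> A \<noteq> {}}"
  shows "finite K" and "card K \<le> S * card A"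
proof -
  let ?I = "\<lambda>a. {\<lceil>2 ^ j * a\<rceil> - int S..<\<lceil>2 ^ j * a\<rceil>}"
  have "K \<subseteq> (\<Union>a\<in>A. ?I a)"
  proof
    fix k assume "k \<in> K"
    then obtain a where "a \<in> A" "0 < 2 ^ j * a - of_int k" "2 ^ j * a - of_int k < real S"
      unfolding K_def using in_wavelet_support_iff by blast
    then have "k \<in> ?I a" by (auto simp: less_ceiling_iff) linarith
    then show "k \<in> (\<Union>a\<in>A. ?I a)" using \<open>a \<in> A\<close> by blast
  qed
  moreover have fin: "finite (\<Union>a\<in>A. ?I a)" using assms(1) by simp
  ultimately show "finite K" by (rule finite_subset)
  have "card K \<le> card (\<Union>a\<in>A. ?I a)"
    using \<open>K \<subseteq> _\<close> fin by (intro card_mono)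
  also have "\<dots> \<le> (\<Sum>a\<in>A. card (?I a))"
    by (rule card_UN_le[OF assms(1)])
  also have "\<dots> = S * card A" by simp
  finally show "card K \<le> S * card A" .
qed

section \<open>Norm of a wavelet sum against its coefficients\<close>

text \<open>
  Of the \<open>p\<close> factors of the sum \<open>p - 1\<close> are bounded pointwise by \<open>\<Psi>\<^sub>0\<close>, and the last one is
  integrated; each term has integral \<open>\<parallel>\<psi>\<parallel>\<^sub>1 / 2\<^sup>j\<close>, where \<open>\<parallel>\<psi>\<parallel>\<^sub>1 \<le> \<Psi>\<^sub>0\<close>. Counted in this way
  the number of terms enters with the exponent \<open>1 / p\<close> after taking roots.
\<close>

lemma synthesis_powr_bound:
  assumes K: "finite K" and p: "p \<ge> 1"
  shows "integrable lborel (\<lambda>x. (\<Sum>k\<in>K. \<bar>\<psi> (2 ^ j * x - of_int k)\<bar>) powr p)"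
    and "(LINT x|lborel. (\<Sum>k\<in>K. \<bar>\<psi> (2 ^ j * x - of_int k)\<bar>) powr p)
          \<le> Psi0 \<psi> powr p * real (card K) / 2 ^ j"
proof -
  let ?s = "\<lambda>x. \<Sum>k\<in>K. \<bar>\<psi> (2 ^ j * x - of_int k)\<bar>"
  have s0: "0 \<le> ?s x" for x by (simp add: sum_nonneg)
  have pw: "?s x powr p \<le> Psi0 \<psi> powr (p - 1) * ?s x" for x
  proof (cases "?s x = 0")
    case False
    then have "?s x powr p = ?s x powr (p - 1) * ?s x"
      using s0[of x] by (simp add: powr_diff)
    also have "\<dots> \<le> Psi0 \<psi> powr (p - 1) * ?s x"
      using s0[of x] sum_translates_le_Psi0[OF K] p by (intro mult_right_mono powr_mono2) auto
    finally show ?thesis .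
  qed simp
  have ik: "integrable lborel (\<lambda>x. \<bar>\<psi> (2 ^ j * x - of_int k)\<bar>)" for k :: int
    using lborel_integrable_dilate[OF integrable_abs[OF integrable_psi], of j "of_int k"] .
  have isum: "integrable lborel (\<lambda>x. Psi0 \<psi> powr (p - 1) * ?s x)"
    using ik by (intro integrable_mult_right Bochner_Integration.integrable_sum) auto
  show "integrable lborel (\<lambda>x. ?s x powr p)"
    by (rule Bochner_Integration.integrable_bound[OF isum]) (use pw s0 in \<open>auto intro: order_trans[OF pw]\<close>)
  then have "(LINT x|lborel. ?s x powr p) \<le> (LINT x|lborel. Psi0 \<psi> powr (p - 1) * ?s x)"
    by (intro integral_mono isum pw)
  also have "\<dots> = Psi0 \<psi> powr (p - 1) * (real (card K) * ((LINT u|lborel. \<bar>\<psi> u\<bar>) / 2 ^ j))"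
    using ik lborel_integral_dilate[of "\<lambda>u. \<bar>\<psi> u\<bar>" j] by simp
  also have "\<dots> \<le> Psi0 \<psi> powr (p - 1) * (real (card K) * (Psi0 \<psi> / 2 ^ j))"
    using L1_norm_le_Psi0 by (intro mult_left_mono divide_right_mono) auto
  also have "\<dots> = Psi0 \<psi> powr p * real (card K) / 2 ^ j"
    using Psi0_pos by (simp add: powr_diff)
  finally show "(LINT x|lborel. ?s x powr p) \<le> Psi0 \<psi> powr p * real (card K) / 2 ^ j" .
qed

text \<open>
  The form in which \<open>synthesis_powr_bound\<close> feeds Minkowski's inequality: the bound is a \<open>p\<close>-th power.
\<close>

lemma scaled_synthesis_powr_bound:
  assumes K: "finite K" and p: "p \<ge> 1" and c: "c \<ge> 0" and t: "t \<ge> 0" "real (card K) / 2 ^ j \<le> t powr p"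
  shows "integrable lborel (\<lambda>x. (c * (\<Sum>k\<in>K. \<bar>\<psi> (2 ^ j * x - of_int k)\<bar>)) powr p)"
    and "(LINT x|lborel. (c * (\<Sum>k\<in>K. \<bar>\<psi> (2 ^ j * x - of_int k)\<bar>)) powr p) \<le> (c * Psi0 \<psi> * t) powr p"
proof -
  let ?s = "\<lambda>x. \<Sum>k\<in>K. \<bar>\<psi> (2 ^ j * x - of_int k)\<bar>"
  have eq: "(c * ?s x) powr p = c powr p * ?s x powr p" for x
    by (simp add: powr_mult)
  show "integrable lborel (\<lambda>x. (c * ?s x) powr p)"
    unfolding eq using synthesis_powr_bound(1)[OF K p] by (rule integrable_mult_right)
  have "(LINT x|lborel. (c * ?s x) powr p) = c powr p * (LINT x|lborel. ?s x powr p)"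
    unfolding eq by simp
  also have "\<dots> \<le> c powr p * (Psi0 \<psi> powr p * (real (card K) / 2 ^ j))"
    using synthesis_powr_bound(2)[OF K p, of j] by (intro mult_left_mono) auto
  also have "\<dots> \<le> c powr p * (Psi0 \<psi> powr p * t powr p)"
    using t by (intro mult_left_mono) auto
  also have "\<dots> = (c * Psi0 \<psi> * t) powr p"
    by (simp add: powr_mult)
  finally show "(LINT x|lborel. (c * ?s x) powr p) \<le> (c * Psi0 \<psi> * t) powr p" .
qed

lemma card_active_indices: "real (card (active_indices j)) / 2 ^ j \<le> real S + 3"
proof -
  have "real (card (active_indices j)) = 2 * 2 ^ j + real S + 1"
    by (simp add: active_indices_def)
  moreover have "real S + 1 \<le> (real S + 1) * 2 ^ j" by simp
  ultimately have "real (card (active_indices j)) \<le> (real S + 3) * 2 ^ j"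
    by (simp add: algebra_simps)
  then show ?thesis by (simp add: field_simps)
qed

text \<open>
  The coefficients are split into a part of size \<open>D\<close> on at most \<open>n\<close> indices and a part of size
  \<open>\<epsilon>\<close> on all active indices, and Minkowski's inequality adds the two. The number of active indices is \<open>O(2\<^sup>j)\<close>, which the factor \<open>2\<^bsup>-j\<^esup>\<close> from the dilation absorbs. For \<open>p \<ge> 1\<close> the counts
  \<open>n\<^bsup>1/p\<^esup>\<close> and \<open>(S + 3)\<^bsup>1/p\<^esup>\<close> are at most \<open>n\<close> and \<open>S + 3\<close>.
\<close>

lemma synthesis_Lp_upper_bound:
  fixes c :: "int \<Rightarrow> real" and j :: nat
  assumes p: "p > 1" and D: "D > 0" and \<epsilon>: "\<epsilon> > 0" and n: "n \<ge> 1"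
    and K: "finite K" "card K \<le> n"
    and c: "\<And>k. k \<in> active_indices j \<Longrightarrow> \<bar>c k\<bar> \<le> (if k \<in> K then D else 0) + \<epsilon>"
  defines "F \<equiv> \<lambda>x. \<Sum>k\<in>active_indices j. c k * \<psi> (2 ^ j * x - of_int k)"
  shows "F \<in> Lp_space p"
    and "Lp_norm p F \<le> D * Psi0 \<psi> * real n * 2 powr (- real j / p) + \<epsilon> * Psi0 \<psi> * (real S + 3)"
proof -
  let ?L = "active_indices j" and ?s = "\<lambda>K x. \<Sum>k\<in>K. \<bar>\<psi> (2 ^ j * x - of_int k)\<bar>"
  have finL: "finite ?L" by (simp add: active_indices_def)
  define t where "t = real n * 2 powr (- real j / p)"
  have t: "t > 0" using n by (simp add: t_def)
  have tp: "real (card K) / 2 ^ j \<le> t powr p"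
  proof -
    have "real (card K) \<le> real n powr 1" using K n by simp
    also have "\<dots> \<le> real n powr p" using n p by (intro powr_mono) auto
    finally have "real (card K) / 2 ^ j \<le> real n powr p / 2 ^ j" by (simp add: divide_right_mono)
    also have "\<dots> = t powr p"
      using p by (simp add: t_def powr_mult powr_divide powr_powr powr_minus_divide powr_realpow)
    finally show ?thesis .
  qed
  have Lp: "real (card ?L) / 2 ^ j \<le> (real S + 3) powr p"
  proof -
    have "real (card ?L) / 2 ^ j \<le> (real S + 3) powr 1" using card_active_indices by simp
    also have "\<dots> \<le> (real S + 3) powr p" using p by (intro powr_mono) auto
    finally show ?thesis .
  qed
  have p1: "p \<ge> 1" using p by simp
  let ?A = "D * Psi0 \<psi> * t" and ?B = "\<epsilon> * Psi0 \<psi> * (real S + 3)"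
  have AB: "?A > 0" "?B > 0" using D \<epsilon> t Psi0_pos by auto
  have tp': "real (card (K \<inter> ?L)) / 2 ^ j \<le> t powr p"
    using tp card_mono[OF K(1), of "K \<inter> ?L"] by (smt (verit) divide_right_mono inf_le1 of_nat_le_iff zero_le_power)
  have D0: "D \<ge> 0" and \<epsilon>0: "\<epsilon> \<ge> 0" and t0: "t \<ge> 0" and S0: "real S + 3 \<ge> 0" using D \<epsilon> t by auto
  have finK: "finite (K \<inter> ?L)" using K(1) by simp
  note main = scaled_synthesis_powr_bound[OF finK p1 D0 t0 tp']
  note rest = scaled_synthesis_powr_bound[OF finL p1 \<epsilon>0 S0 Lp]
  have meas: "(\<lambda>x. D * ?s (K \<inter> ?L) x) \<in> borel_measurable lborel" "(\<lambda>x. \<epsilon> * ?s ?L x) \<in> borel_measurable lborel"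
    by measurable
  have nonneg: "0 \<le> D * ?s (K \<inter> ?L) x" "0 \<le> \<epsilon> * ?s ?L x" for x
    using D0 \<epsilon>0 by (auto intro!: mult_nonneg_nonneg sum_nonneg)
  note sum = Minkowski_bound[OF p1 AB meas nonneg main(1) rest(1) main(2) rest(2)]
  have pw: "\<bar>F x\<bar> \<le> D * ?s (K \<inter> ?L) x + \<epsilon> * ?s ?L x" for x
  proof -
    have "\<bar>F x\<bar> \<le> (\<Sum>k\<in>?L. \<bar>c k\<bar> * \<bar>\<psi> (2 ^ j * x - of_int k)\<bar>)"
      unfolding F_def abs_mult[symmetric] by (rule sum_abs)
    also have "\<dots> \<le> (\<Sum>k\<in>?L. ((if k \<in> K then D else 0) + \<epsilon>) * \<bar>\<psi> (2 ^ j * x - of_int k)\<bar>)"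
      by (intro sum_mono mult_right_mono c) auto
    also have "\<dots> = (\<Sum>k\<in>?L. if k \<in> K then D * \<bar>\<psi> (2 ^ j * x - of_int k)\<bar> else 0)
        + (\<Sum>k\<in>?L. \<epsilon> * \<bar>\<psi> (2 ^ j * x - of_int k)\<bar>)"
      unfolding sum.distrib[symmetric] by (intro sum.cong) (auto simp: distrib_right)
    also have "\<dots> = D * ?s (K \<inter> ?L) x + \<epsilon> * ?s ?L x"
      using finL by (simp add: sum_distrib_left sum.inter_restrict[symmetric] Int_commute)
    finally show ?thesis .
  qed
  have pwp: "\<bar>F x\<bar> powr p \<le> (D * ?s (K \<inter> ?L) x + \<epsilon> * ?s ?L x) powr p" for x
    using pw[of x] p by (intro powr_mono2) auto
  have Fm: "F \<in> borel_measurable lborel" unfolding F_def by measurable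
  have iF: "integrable lborel (\<lambda>x. \<bar>F x\<bar> powr p)"
    by (rule Bochner_Integration.integrable_bound[OF sum(1)]) (use Fm pwp in auto)
  then show "F \<in> Lp_space p" using Fm by (simp add: Lp_space_def)
  have "(LINT x|lborel. \<bar>F x\<bar> powr p) \<le> (?A + ?B) powr p"
    using integral_mono[OF iF sum(1) pwp] sum(2) by linarith
  then have "(LINT x|lborel. \<bar>F x\<bar> powr p) powr (1 / p) \<le> ((?A + ?B) powr p) powr (1 / p)"
    using p by (intro powr_mono2) auto
  also have "\<dots> = ?A + ?B"
    using p AB by (simp add: powr_powr)
  finally show "Lp_norm p F \<le> D * Psi0 \<psi> * real n * 2 powr (- real j / p) + \<epsilon> * Psi0 \<psi> * (real S + 3)"
    by (simp add: Lp_norm_def t_def mult.assoc)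
qed

lemma synthesis_coefficient:
  fixes c :: "int \<Rightarrow> real"
  assumes L: "finite L" "k \<in> L"
  shows "(LINT x|lborel. (\<Sum>l\<in>L. c l * \<psi> (2 ^ j * x - of_int l)) * \<psi> (2 ^ j * x - of_int k)) = c k / 2 ^ j"
proof -
  have int: "integrable lborel (\<lambda>u. \<psi> (u - of_int l) * \<psi> (u - of_int k))" for l :: int
  proof -
    have "integrable lborel (\<lambda>u. \<psi> (u + (of_int k - of_int l)) * \<psi> u)"
      by (intro integrable_continuous_times_psi continuous_on_compose2[OF cont, of UNIV "\<lambda>u. u + (of_int k - of_int l)"])
         (auto intro!: continuous_intros)
    from lborel_integrable_dilate[OF this, of 0 "of_int k"] show ?thesis by (simp add: algebra_simps)
  qed
  have "(LINT x|lborel. (\<Sum>l\<in>L. c l * \<psi> (2 ^ j * x - of_int l)) * \<psi> (2 ^ j * x - of_int k))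
      = (LINT u|lborel. (\<Sum>l\<in>L. c l * \<psi> (u - of_int l)) * \<psi> (u - of_int k)) / 2 ^ j"
    using lborel_integral_dilate[of "\<lambda>u. (\<Sum>l\<in>L. c l * \<psi> (u - of_int l)) * \<psi> (u - of_int k)" j 0] by simp
  also have "(LINT u|lborel. (\<Sum>l\<in>L. c l * \<psi> (u - of_int l)) * \<psi> (u - of_int k))
      = (LINT u|lborel. (\<Sum>l\<in>L. c l * (\<psi> (u - of_int l) * \<psi> (u - of_int k))))"
    by (simp add: sum_distrib_right mult.assoc)
  also have "\<dots> = (\<Sum>l\<in>L. LINT u|lborel. c l * (\<psi> (u - of_int l) * \<psi> (u - of_int k)))"
    by (intro Bochner_Integration.integral_sum integrable_mult_right int)
  also have "\<dots> = (\<Sum>l\<in>L. if l = k then c k else 0)"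
    by (intro sum.cong refl) (auto simp: ortho)
  also have "\<dots> = c k" using L by simp
  finally show ?thesis .
qed

text \<open>
  Orthonormality turns the coefficient into an integral of the sum against a single wavelet, whose
  norm in the dual exponent \<open>q\<close> is at most \<open>\<Psi>\<^sub>0 2\<^bsup>-j/q\<^esup>\<close>. The norm of the sum is represented by a
  positive upper bound \<open>A\<close>.
\<close>

lemma synthesis_coefficient_le:
  fixes c :: "int \<Rightarrow> real" and j :: nat
  assumes L: "finite L" "k \<in> L" and p: "p > 1" and A: "A > 0"
  defines "F \<equiv> \<lambda>x. \<Sum>l\<in>L. c l * \<psi> (2 ^ j * x - of_int l)"
  assumes iF: "integrable lborel (\<lambda>x. \<bar>F x\<bar> powr p)" and bF: "(LINT x|lborel. \<bar>F x\<bar> powr p) \<le> A powr p"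
  shows "\<bar>c k\<bar> \<le> Psi0 \<psi> * 2 powr (real j / p) * A"
proof -
  define q where "q = p / (p - 1)"
  have q: "q > 1" "1 / p + 1 / q = 1" and jq: "real j * (1 / p) = real j * (1 - 1 / q)"
    using p by (auto simp: q_def field_simps)
  let ?B = "Psi0 \<psi> * 2 powr (- real j / q)"
  have G: "integrable lborel (\<lambda>x. \<bar>\<psi> (2 ^ j * x - of_int k)\<bar> powr q)"
    "(LINT x|lborel. \<bar>\<psi> (2 ^ j * x - of_int k)\<bar> powr q) \<le> Psi0 \<psi> powr q / 2 ^ j"
    using synthesis_powr_bound[of "{k}" q j] q by auto
  have "?B powr q = Psi0 \<psi> powr q * 2 powr (- real j)"
    using q by (simp add: powr_mult powr_powr)
  then have "Psi0 \<psi> powr q / 2 ^ j = ?B powr q"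
    by (simp add: powr_minus_divide powr_realpow)
  then have "\<bar>LINT x|lborel. F x * \<psi> (2 ^ j * x - of_int k)\<bar> \<le> A * ?B"
    using G by (intro Holder_bound[OF p q A]) (use Psi0_pos iF bF in \<open>auto simp: F_def\<close>)
  then have "\<bar>c k\<bar> \<le> 2 ^ j * (A * ?B)"
    unfolding F_def synthesis_coefficient[OF L] by (simp add: field_simps)
  also have "\<dots> = Psi0 \<psi> * (2 ^ j * 2 powr (- real j / q)) * A"
    by (simp only: mult_ac)
  also have "2 ^ j * 2 powr (- real j / q) = (2::real) powr (real j + - real j / q)"
    by (simp only: powr_add) (simp add: powr_realpow)
  also have "real j + - real j / q = real j / p"
    using jq by (simp add: right_diff_distrib)
  finally show ?thesis .
qed

text \<open>
  Passing to the limit \<open>A \<rightarrow> \<parallel>F\<parallel>\<^sub>p\<close> from above covers also the case in which the norm is \<open>0\<close>.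
\<close>

lemma synthesis_Lp_lower_bound:
  fixes c :: "int \<Rightarrow> real" and j :: nat
  assumes p: "p > 1" and L: "finite L" "k \<in> L"
  defines "F \<equiv> \<lambda>x. \<Sum>l\<in>L. c l * \<psi> (2 ^ j * x - of_int l)"
  assumes F: "F \<in> Lp_space p"
  shows "\<bar>c k\<bar> \<le> Psi0 \<psi> * 2 powr (real j / p) * Lp_norm p F"
proof -
  let ?I = "LINT x|lborel. \<bar>F x\<bar> powr p"
  have iF: "integrable lborel (\<lambda>x. \<bar>F x\<bar> powr p)" using F by (simp add: Lp_space_def)
  have I: "?I \<ge> 0" by (simp add: integral_nonneg_AE)
  have norm: "Lp_norm p F powr p = ?I" "Lp_norm p F \<ge> 0"
    using p I by (simp_all add: Lp_norm_def powr_powr)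
  have bound: "\<bar>c k\<bar> \<le> Psi0 \<psi> * 2 powr (real j / p) * A" if A: "A > Lp_norm p F" for A
  proof -
    have "?I \<le> A powr p"
      unfolding norm(1)[symmetric] using A p norm(2) by (intro powr_mono2) auto
    then show ?thesis
      using A norm(2) iF unfolding F_def by (intro synthesis_coefficient_le[OF L p]) auto
  qed
  define B where "B = Psi0 \<psi> * 2 powr (real j / p)"
  have B: "B > 0" using Psi0_pos by (simp add: B_def)
  have "\<bar>c k\<bar> / B \<le> Lp_norm p F"
  proof (rule dense_ge)
    fix A assume "A > Lp_norm p F"
    then show "\<bar>c k\<bar> / B \<le> A" using bound[of A] B by (simp add: B_def[symmetric] field_simps)
  qed
  then show ?thesis using B by (simp add: B_def[symmetric] field_simps)
qed

section \<open>The two-sided bound\<close>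

lemma inverse_power2_eq_powr:
  "1 / (2::real) ^ (j * n) = 2 powr (- (real j * real n))"
proof -
  have "(2::real) powr real (j * n) = 2 ^ (j * n)" by (rule powr_realpow) simp
  then show ?thesis by (simp add: powr_minus_divide)
qed

text \<open>
  The proposition for one function, with explicit error terms: both are multiples of the constant
  \<open>C\<close> from the coefficient estimates.
\<close>

theorem detail_operator_Lp_bounds:
  assumes \<delta>: "0 < \<delta>" and nonzero: "\<And>x. x \<in> {0<..1 + \<delta>} \<Longrightarrow> \<psi> x \<noteq> 0"
    and p: "1 < p" and \<Delta>\<^sub>1: "0 < \<Delta>\<^sub>1"
    and f: "f \<in> class_S d \<Delta>\<^sub>1 \<Delta>\<^sub>2 N\<^sub>S"
  defines "m \<equiv> pw_index f"
  obtains C N where "C > 0"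
    and "\<forall>j\<ge>N. detail_operator \<psi> j f \<in> Lp_space p \<and>
      1 / Psi0 \<psi> * (Psi1 \<psi> d \<delta> / (fact m * 2 powr (real j * (real m + 1 / p)))) * \<Delta>\<^sub>1
          - C / Psi0 \<psi> * 2 powr (- (real j * (real m + 1)))
        \<le> Lp_norm p (detail_operator \<psi> j f) \<and>
      Lp_norm p (detail_operator \<psi> j f)
        \<le> Psi0 \<psi> * (Psi2 \<psi> * real S ^ (m + 2) / (fact (m + 1) * 2 powr (real j * (real m + 1 / p))))
            * real N\<^sub>S * \<Delta>\<^sub>2 + C * Psi0 \<psi> * (real S + 3) * 2 powr (- (real j * (real m + 1)))"
proof -
  obtain m' as where ps': "piecewise_smooth f m' as" and md': "m' \<le> d"
    and jumps': "\<forall>a\<in>set as. \<Delta>\<^sub>1 \<le> \<bar>deriv_left m' f a - deriv_right m' f a\<bar> \<and>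
                         \<bar>deriv_left m' f a - deriv_right m' f a\<bar> \<le> \<Delta>\<^sub>2"
    and len: "length as \<le> N\<^sub>S" and sup: "closure (support_on UNIV f) \<subseteq> {-1..1}"
    using f unfolding class_S_def by blast
  have "m' = m" unfolding m_def using pw_index_eq[OF ps'] by simp
  note ps = ps'[unfolded this] and md = md'[unfolded this] and jumps = jumps'[unfolded this]
  have fs: "f y = 0" if "y \<notin> {-1..1}" for y
    using sup closure_subset[of "support_on UNIV f"] that by (auto simp: support_on_def)
  define J where "J a = deriv_right m f a - deriv_left m f a" for a
  have J: "\<Delta>\<^sub>1 \<le> \<bar>J a\<bar>" "\<bar>J a\<bar> \<le> \<Delta>\<^sub>2" if "a \<in> set as" for a
    using jumps that unfolding J_def by (auto simp: abs_minus_commute)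
  obtain a\<^sub>0 where a\<^sub>0: "a\<^sub>0 \<in> set as"
    using piecewise_smooth_nonempty[OF ps] by (meson last_in_set)
  then have \<Delta>\<^sub>2: "\<Delta>\<^sub>2 > 0" using J[of a\<^sub>0] \<Delta>\<^sub>1 by linarith
  have "a\<^sub>0 \<in> {-1..1}"
    using defect_in_support[of f m a\<^sub>0] fs J(1)[OF a\<^sub>0] \<Delta>\<^sub>1 by (auto simp: J_def)
  obtain B where B: "\<And>y. y \<notin> set as \<Longrightarrow> \<bar>f y\<bar> \<le> B"
    using piecewise_smooth_bounded[OF ps] fs by blast
  obtain C N where C: "C > 0"
    and regular: "\<forall>j\<ge>N. \<forall>k\<in>active_indices j. wavelet_support j k \<inter> set as = {} \<longrightarrow>
      \<bar>wavelet_coeff \<psi> f j k\<bar> \<le> C / 2 ^ (j * Suc m)"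
    and singular: "\<forall>j\<ge>N. \<forall>k\<in>active_indices j. \<forall>a\<in>wavelet_support j k \<inter> set as.
      \<bar>wavelet_coeff \<psi> f j k - (deriv_right m f a - deriv_left m f a) / fact m / 2 ^ (j * m)
         * jump_moment m (2 ^ j * a - of_int k)\<bar> \<le> C / 2 ^ (j * Suc m)"
    using wavelet_coeff_estimates[OF ps md] .
  have "S \<ge> 1" "N\<^sub>S \<ge> 1"
    using S_pos len piecewise_smooth_nonempty[OF ps] by (cases as; auto)+
  show ?thesis
  proof (rule that[OF C, of N], intro allI impI)
    fix j assume j: "j \<ge> N"
    define w where "w = C / 2 ^ (j * Suc m)"
    have w: "w = C * 2 powr (- (real j * (real m + 1)))" "w > 0"
      using inverse_power2_eq_powr[of j "Suc m"] C by (auto simp: w_def field_simps)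
    have scale: "2 powr (real j * (real m + 1 / p)) = 2 ^ (j * m) * 2 powr (real j / p)"
    proof -
      have "real j * (real m + 1 / p) = real (j * m) + real j / p" by (simp add: distrib_left)
      then show ?thesis by (simp only: powr_add) (simp add: powr_realpow del: of_nat_mult)
    qed
    let ?c = "wavelet_coeff \<psi> f j"
    have F: "detail_operator \<psi> j f = (\<lambda>x. \<Sum>k\<in>active_indices j. ?c k * \<psi> (2 ^ j * x - of_int k))"
      using detail_operator_eq_sum[OF piecewise_smooth_measurable[OF ps] finite_set B fs] by blast
    define K where "K = {k. wavelet_support j k \<inter> set as \<noteq> {}}"
    have K: "finite K" "card K \<le> S * N\<^sub>S"
    proof -
      show "finite K" unfolding K_def by (rule card_singular_indices) simp
      have "card K \<le> S * card (set as)" unfolding K_def by (rule card_singular_indices) simp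
      also have "\<dots> \<le> S * N\<^sub>S" using card_length[of as] len by (intro mult_le_mono) auto
      finally show "card K \<le> S * N\<^sub>S" .
    qed
    \<comment> \<open>the largest main term: jump at most \<open>\<Delta>\<^sub>2\<close>, jump moment as in \<open>abs_jump_moment_le\<close>\<close>
    define D where "D = \<Delta>\<^sub>2 / fact m / 2 ^ (j * m) * (Psi2 \<psi> * real S ^ (m + 1) / real (m + 1))"
    have D: "D > 0" unfolding D_def using \<Delta>\<^sub>2 Psi2_pos S_pos by simp
    have c: "\<bar>?c k\<bar> \<le> (if k \<in> K then D else 0) + w" if k: "k \<in> active_indices j" for k
    proof (cases "k \<in> K")
      case True
      then obtain a where a: "a \<in> wavelet_support j k \<inter> set as" by (auto simp: K_def)
      define s where "s = 2 ^ j * a - of_int k"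
      have s: "0 \<le> s" "s \<le> real S" using a in_wavelet_support_iff[of a j k] by (auto simp: s_def)
      have "\<bar>?c k - J a / fact m / 2 ^ (j * m) * jump_moment m s\<bar> \<le> w"
        using singular j k a unfolding J_def s_def w_def by blast
      moreover have "\<bar>J a / fact m / 2 ^ (j * m) * jump_moment m s\<bar> \<le> D"
        unfolding D_def abs_mult using a J(2)[of a] \<Delta>\<^sub>2
        by (intro mult_mono abs_jump_moment_le s) (auto simp: abs_divide divide_right_mono)
      ultimately have "\<bar>?c k\<bar> \<le> D + w" by linarith
      then show ?thesis using True by simp
    next
      case False
      then have "\<bar>?c k\<bar> \<le> w" using regular j k unfolding K_def w_def by blast
      then show ?thesis using False by simp
    qed
    have n: "1 \<le> S * N\<^sub>S" using \<open>S \<ge> 1\<close> \<open>N\<^sub>S \<ge> 1\<close> by simp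
    have upper: "detail_operator \<psi> j f \<in> Lp_space p"
      "Lp_norm p (detail_operator \<psi> j f)
        \<le> D * Psi0 \<psi> * real (S * N\<^sub>S) * 2 powr (- real j / p) + w * Psi0 \<psi> * (real S + 3)"
      unfolding F by (rule synthesis_Lp_upper_bound[where j = j and c = ?c, OF p D w(2) n K c], assumption)+
    have "D * Psi0 \<psi> * real (S * N\<^sub>S) * 2 powr (- real j / p)
        = Psi0 \<psi> * (Psi2 \<psi> * real S ^ (m + 2) / (fact (m + 1) * 2 powr (real j * (real m + 1 / p)))) * real N\<^sub>S * \<Delta>\<^sub>2"
    proof -
      have regroup: "\<Delta>\<^sub>2 / x / y * (Psi2 \<psi> * u / v) * Psi0 \<psi> * (z * N) * (1 / t)
          = Psi0 \<psi> * (Psi2 \<psi> * (u * z) / (v * x * (y * t))) * N * \<Delta>\<^sub>2" for x y u v z N t :: real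
        by (simp add: mult_ac)
      have "2 powr (- real j / p) = 1 / (2::real) powr (real j / p)"
        by (simp add: powr_minus_divide)
      moreover have "real S ^ (m + 2) = real S ^ (m + 1) * real S" by simp
      moreover have "fact (m + 1) = real (m + 1) * fact m" by simp
      ultimately show ?thesis
        unfolding D_def scale by (simp only: regroup of_nat_mult)
    qed
    moreover have "w * Psi0 \<psi> * (real S + 3) = C * Psi0 \<psi> * (real S + 3) * 2 powr (- (real j * (real m + 1)))"
      unfolding w(1) by simp
    ultimately have up: "Lp_norm p (detail_operator \<psi> j f)
        \<le> Psi0 \<psi> * (Psi2 \<psi> * real S ^ (m + 2) / (fact (m + 1) * 2 powr (real j * (real m + 1 / p))))
            * real N\<^sub>S * \<Delta>\<^sub>2 + C * Psi0 \<psi> * (real S + 3) * 2 powr (- (real j * (real m + 1)))"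
      using upper(2) by linarith
    \<comment> \<open>the index that puts \<open>s\<close> into the window \<open>[\<delta>, 1 + \<delta>)\<close>, where the jump moment is bounded below\<close>
    define k where "k = \<lfloor>2 ^ j * a\<^sub>0 - \<delta>\<rfloor>"
    define s where "s = 2 ^ j * a\<^sub>0 - of_int k"
    have s: "\<delta> \<le> s" "s < 1 + \<delta>" unfolding s_def k_def by linarith+
    have "1 + \<delta> \<le> real S" using nonzero[of "1 + \<delta>"] supp[of "1 + \<delta>"] \<delta> by force
    then have a\<^sub>0k: "a\<^sub>0 \<in> wavelet_support j k \<inter> set as"
      using s \<delta> a\<^sub>0 in_wavelet_support_iff[of a\<^sub>0 j k] by (auto simp: s_def)
    have kL: "k \<in> active_indices j"
    proof -
      have "- (2 ^ j) \<le> 2 ^ j * a\<^sub>0" "2 ^ j * a\<^sub>0 \<le> 2 ^ j"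
        using \<open>a\<^sub>0 \<in> {-1..1}\<close> mult_left_mono[of "-1" a\<^sub>0 "2 ^ j"] by auto
      then have "- (2 ^ j) - real S \<le> of_int k" "real_of_int k \<le> 2 ^ j"
        using s \<delta> \<open>1 + \<delta> \<le> real S\<close> unfolding s_def by linarith+
      then have "real_of_int (- (2 ^ j) - int S) \<le> of_int k" "real_of_int k \<le> real_of_int (2 ^ j)"
        by simp_all
      then show ?thesis unfolding active_indices_def by (simp only: of_int_le_iff atLeastAtMost_iff)
    qed
    have finL: "finite (active_indices j)" by (simp add: active_indices_def)
    have "\<Delta>\<^sub>1 / fact m / 2 ^ (j * m) * Psi1 \<psi> d \<delta> \<le> \<bar>J a\<^sub>0\<bar> / fact m / 2 ^ (j * m) * \<bar>jump_moment m s\<bar>"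
    proof -
      have "Psi1 \<psi> d \<delta> \<le> \<bar>jump_moment m s\<bar>"
        using Psi1_le_jump_moment[OF md \<delta> s(1), of "1 + \<delta>"] s(2) nonzero by simp
      moreover have "0 \<le> Psi1 \<psi> d \<delta>"
        unfolding Psi1_def by (subst Min_ge_iff) auto
      ultimately show ?thesis
        using J(1)[OF a\<^sub>0] \<Delta>\<^sub>1 by (intro mult_mono divide_right_mono) auto
    qed
    also have "\<dots> = \<bar>J a\<^sub>0 / fact m / 2 ^ (j * m) * jump_moment m s\<bar>"
      by (simp add: abs_mult abs_divide)
    also have "\<dots> \<le> \<bar>?c k\<bar> + w"
    proof -
      have "\<bar>?c k - J a\<^sub>0 / fact m / 2 ^ (j * m) * jump_moment m s\<bar> \<le> w"
        using singular j kL a\<^sub>0k unfolding J_def s_def w_def by blast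
      then show ?thesis by linarith
    qed
    finally have "\<Delta>\<^sub>1 / fact m / 2 ^ (j * m) * Psi1 \<psi> d \<delta> - w \<le> \<bar>?c k\<bar>" by simp
    also have "\<dots> \<le> Psi0 \<psi> * 2 powr (real j / p) * Lp_norm p (detail_operator \<psi> j f)"
      using synthesis_Lp_lower_bound[OF p finL kL, of ?c j] upper(1) unfolding F by blast
    finally have "(\<Delta>\<^sub>1 / fact m / 2 ^ (j * m) * Psi1 \<psi> d \<delta> - w) / (Psi0 \<psi> * 2 powr (real j / p))
        \<le> Lp_norm p (detail_operator \<psi> j f)"
      using Psi0_pos by (simp add: divide_le_eq mult.commute)
    moreover have "w / (Psi0 \<psi> * 2 powr (real j / p)) \<le> w / Psi0 \<psi>"
    proof -
      have "(1::real) \<le> 2 powr (real j / p)" using p by (intro ge_one_powr_ge_zero) auto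
      then show ?thesis using w(2) Psi0_pos by (intro divide_left_mono) auto
    qed
    moreover have "\<Delta>\<^sub>1 / fact m / 2 ^ (j * m) * Psi1 \<psi> d \<delta> / (Psi0 \<psi> * 2 powr (real j / p))
        = 1 / Psi0 \<psi> * (Psi1 \<psi> d \<delta> / (fact m * 2 powr (real j * (real m + 1 / p)))) * \<Delta>\<^sub>1"
      unfolding scale by (simp add: mult_ac)
    moreover have "w / Psi0 \<psi> = C / Psi0 \<psi> * 2 powr (- (real j * (real m + 1)))"
      unfolding w(1) by simp
    ultimately have low: "1 / Psi0 \<psi> * (Psi1 \<psi> d \<delta> / (fact m * 2 powr (real j * (real m + 1 / p)))) * \<Delta>\<^sub>1
          - C / Psi0 \<psi> * 2 powr (- (real j * (real m + 1)))
        \<le> Lp_norm p (detail_operator \<psi> j f)"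
      unfolding diff_divide_distrib by linarith
    show "detail_operator \<psi> j f \<in> Lp_space p \<and>
      1 / Psi0 \<psi> * (Psi1 \<psi> d \<delta> / (fact m * 2 powr (real j * (real m + 1 / p)))) * \<Delta>\<^sub>1
          - C / Psi0 \<psi> * 2 powr (- (real j * (real m + 1)))
        \<le> Lp_norm p (detail_operator \<psi> j f) \<and>
      Lp_norm p (detail_operator \<psi> j f)
        \<le> Psi0 \<psi> * (Psi2 \<psi> * real S ^ (m + 2) / (fact (m + 1) * 2 powr (real j * (real m + 1 / p))))
            * real N\<^sub>S * \<Delta>\<^sub>2 + C * Psi0 \<psi> * (real S + 3) * 2 powr (- (real j * (real m + 1)))"
      using upper(1) low up by blast
  qed
qed

end

lemma regular_wavelet_basis_compact_wavelet:
  assumes "regular_wavelet_basis r \<phi> \<psi> S d"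
  shows "compact_wavelet \<psi> S d"
proof
  show "continuous_on UNIV \<psi>"
    using assms Ck_on_UNIV_continuous_higher_deriv[of r \<psi> 0] unfolding regular_wavelet_basis_def by simp
  show "\<psi> x = 0" if "x \<notin> {0..real S}" for x
  proof (rule ccontr)
    assume "\<psi> x \<noteq> 0"
    then have "x \<in> closure (support_on UNIV \<psi>)"
      by (intro subsetD[OF closure_subset]) (simp add: support_on_def)
    then show False using assms that unfolding regular_wavelet_basis_def by auto
  qed
  show "(LINT x|lborel. x ^ k * \<psi> x) = 0" if "k \<le> d" for k
    using assms that unfolding regular_wavelet_basis_def by blast
  show "(LINT x|lborel. \<psi> (x - of_int k) * \<psi> (x - of_int l)) = (if k = l then 1 else 0)" for k l :: int
  proof -
    have "L2_inner (\<lambda>x. complex_of_real (\<psi> (x - of_int k))) (\<lambda>x. complex_of_real (\<psi> (x - of_int l)))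
        = (if k = l then 1 else 0)"
      using assms unfolding regular_wavelet_basis_def L2_orthonormal_basis_def by blast
    moreover have "L2_inner (\<lambda>x. complex_of_real (\<psi> (x - of_int k))) (\<lambda>x. complex_of_real (\<psi> (x - of_int l)))
        = complex_of_real (LINT x|lborel. \<psi> (x - of_int k) * \<psi> (x - of_int l))"
      unfolding L2_inner_def by (simp flip: of_real_mult)
    ultimately have "complex_of_real (LINT x|lborel. \<psi> (x - of_int k) * \<psi> (x - of_int l)) = (if k = l then 1 else 0)"
      by simp
    then show ?thesis by (cases "k = l") simp_all
  qed
qed

theorem proposition3p1:
  fixes \<phi> :: "real \<Rightarrow> complex" and \<psi> :: "real \<Rightarrow> real"
    and r S d N\<^sub>S :: nat and \<delta>\<^sub>1 \<Delta>\<^sub>1 \<Delta>\<^sub>2 p :: real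
  assumes rwb: "regular_wavelet_basis r \<phi> \<psi> S d"
    and \<delta>\<^sub>1: "0 < \<delta>\<^sub>1" "\<delta>\<^sub>1 < 1"
    and nonzero: "\<And>x. x \<in> {0<..1 + \<delta>\<^sub>1} \<Longrightarrow> \<psi> x \<noteq> 0"
    and p: "1 < p"
    and \<Delta>: "0 < \<Delta>\<^sub>1" "\<Delta>\<^sub>1 \<le> \<Delta>\<^sub>2"
  shows "\<forall>f \<in> class_S d \<Delta>\<^sub>1 \<Delta>\<^sub>2 N\<^sub>S. let m = pw_index f in
    \<exists>E\<^sub>1 \<in> O(\<lambda>j::nat. 2 powr (- (real j * (real m + 1)))).
    \<exists>E\<^sub>2 \<in> O(\<lambda>j::nat. 2 powr (- (real j * (real m + 1)))).
    \<exists>N. \<forall>j\<ge>N.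
      detail_operator \<psi> j f \<in> Lp_space p \<and>
      1 / Psi0 \<psi> * (Psi1 \<psi> d \<delta>\<^sub>1 / (fact m * 2 powr (real j * (real m + 1 / p)))) * \<Delta>\<^sub>1 - E\<^sub>1 j
        \<le> Lp_norm p (detail_operator \<psi> j f) \<and>
      Lp_norm p (detail_operator \<psi> j f)
        \<le> Psi0 \<psi> * (Psi2 \<psi> * real S ^ (m + 2) / (fact (m + 1) * 2 powr (real j * (real m + 1 / p))))
            * real N\<^sub>S * \<Delta>\<^sub>2 + E\<^sub>2 j"
proof
  interpret compact_wavelet \<psi> S d
    using rwb by (rule regular_wavelet_basis_compact_wavelet)
  fix f assume f: "f \<in> class_S d \<Delta>\<^sub>1 \<Delta>\<^sub>2 N\<^sub>S"
  obtain C N where C: "C > 0"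
    and bounds: "\<forall>j\<ge>N. detail_operator \<psi> j f \<in> Lp_space p \<and>
      1 / Psi0 \<psi> * (Psi1 \<psi> d \<delta>\<^sub>1 / (fact (pw_index f) * 2 powr (real j * (real (pw_index f) + 1 / p)))) * \<Delta>\<^sub>1
          - C / Psi0 \<psi> * 2 powr (- (real j * (real (pw_index f) + 1)))
        \<le> Lp_norm p (detail_operator \<psi> j f) \<and>
      Lp_norm p (detail_operator \<psi> j f)
        \<le> Psi0 \<psi> * (Psi2 \<psi> * real S ^ (pw_index f + 2) / (fact (pw_index f + 1) * 2 powr (real j * (real (pw_index f) + 1 / p))))
            * real N\<^sub>S * \<Delta>\<^sub>2 + C * Psi0 \<psi> * (real S + 3) * 2 powr (- (real j * (real (pw_index f) + 1)))"
    using detail_operator_Lp_bounds[OF \<delta>\<^sub>1(1) nonzero p \<Delta>(1) f] by blast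
  let ?w = "\<lambda>j::nat. (2::real) powr (- (real j * (real (pw_index f) + 1)))"
  have O: "(\<lambda>j. c * ?w j) \<in> O(?w)" for c
    by (rule bigoI[of _ "\<bar>c\<bar>"]) (simp add: abs_mult)
  show "let m = pw_index f in
    \<exists>E\<^sub>1 \<in> O(\<lambda>j::nat. 2 powr (- (real j * (real m + 1)))).
    \<exists>E\<^sub>2 \<in> O(\<lambda>j::nat. 2 powr (- (real j * (real m + 1)))).
    \<exists>N. \<forall>j\<ge>N.
      detail_operator \<psi> j f \<in> Lp_space p \<and>
      1 / Psi0 \<psi> * (Psi1 \<psi> d \<delta>\<^sub>1 / (fact m * 2 powr (real j * (real m + 1 / p)))) * \<Delta>\<^sub>1 - E\<^sub>1 j
        \<le> Lp_norm p (detail_operator \<psi> j f) \<and>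
      Lp_norm p (detail_operator \<psi> j f)
        \<le> Psi0 \<psi> * (Psi2 \<psi> * real S ^ (m + 2) / (fact (m + 1) * 2 powr (real j * (real m + 1 / p))))
            * real N\<^sub>S * \<Delta>\<^sub>2 + E\<^sub>2 j"
    unfolding Let_def
    by (rule bexI[OF _ O[of "C / Psi0 \<psi>"]], rule bexI[OF _ O[of "C * Psi0 \<psi> * (real S + 3)"]],
        rule exI[of _ N]) (rule bounds)
qed

end
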